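(* Let $q\ge3$. Define $$\hat\Lambda_q:=\max_{{\bf z}\in\widetilde{\mathcal M}^{q-1}_{\le},\,\|{\bf z}\|=1}\ \min_{1\le k\le q-1}{\bf z}'{\bf z}^q_k .$$ Put $b^q_k=\sqrt{\frac{3k(q-k)}{q(q+1)}}$ for $0\le k\le q$, $\hat a^q_k=b^q_{k-1}-b^q_k$ for $1\le k\le q$, $\hat{\bf a}^q=(\hat a^q_1,\dots,\hat a^q_q)'$, and $\hat{\bf z}^q=\hat{\bf a}^q/\|\hat{\bf a}^q\|$. Then the unit vector $\hat{\bf z}^q$ uniquely attains the maximum $\hat\Lambda_q$. Thus $$\hat{\bf y}^q:=\|\bar{\bf y}^q\|\,\hat{\bf z}^q=\sqrt{\frac{q(q^2-1)}{12}}\,\frac{\hat{\bf a}^q}{\|\hat{\bf a}^q\|}$$ uniquely minimizes both $L^{q-2}(\Pi({\bf y}))$ and $A^{q-2}(\Pi({\bf y}))$ over ${\bf y}\in\widetilde{\mathcal S}^{q-2}_{\|\bar{\bf y}^q\|}\cap\mathbb{R}^q_{\le}$, and $\hat{\bf y}^q\ne\bar{\bf y}^q$ when $q\ge4$. The minimum values are $$L^{q-2}(\Pi(\hat{\bf y}^q))=\beta^{q-2}\!\left(\frac{1}{\|\hat{\bf a}^q\|}\sqrt{\frac{3}{q+1}}\right),\qquad A^{q-2}(\Pi(\hat{\bf y}^q))=\cos^{-1}\!\left(\frac{1}{\|\hat{\bf a}^q\|}\sqrt{\frac{3}{q+1}}\right).$$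
   Context: Superscripts $q$ on vectors are indices. ${\bf e}^q=(1,\dots,1)'\in\mathbb{R}^q$; $\|\cdot\|$ is the Euclidean norm; $\mathbb{R}^q_\le=\{{\bf x}\in\mathbb{R}^q:x_1\le\cdots\le x_q\}$; $\widetilde{\mathcal M}^{q-1}=\{{\bf v}\in\mathbb{R}^q : {\bf v}'{\bf e}^q=0\}$; $\widetilde{\mathcal M}^{q-1}_{\le}=\widetilde{\mathcal M}^{q-1}\cap\mathbb{R}^q_\le$. $\bar{\bf y}^q=\left(-\frac{q-1}{2},-\frac{q-3}{2},\dots,\frac{q-3}{2},\frac{q-1}{2}\right)'$, so $\|\bar{\bf y}^q\|=\sqrt{q(q^2-1)/12}$. For $1\le k\le q-1$, ${\bf z}^q_k\in\widetilde{\mathcal M}^{q-1}_\le$ is the unit vector whose first $k$ components equal $-\frac{1}{\sqrt q}\sqrt{\frac{q-k}{k}}$ and whose last $q-k$ components equal $\frac1{\sqrt q}\sqrt{\frac{k}{q-k}}$. For ${\bf y}\in\mathbb{R}^q$, $\Pi({\bf y})=\{P{\bf y} : P \text{ a } q\times q \text{ permutation matrix}\}$. For $\rho>0$, $\widetilde{\mathcal S}^{q-2}_\rho=\{{\bf v}\in\widetilde{\mathcal M}^{q-1}:\|{\bf v}\|=\rho\}$, and $\widetilde{\bf U}^{q-2}_\rho$ is the uniform (normalized rotation-invariant) probability measure on it. For ${\bf w}\in\widetilde{\mathcal S}^{q-2}_\rho$ and $-1\le t<1$, $C({\bf w};t)=\{{\bf v}\in\widetilde{\mathcal S}^{q-2}_{\rho}:{\bf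 v}'{\bf w}>\rho^2t\}$ (open spherical cap). For a nonempty finite $N\subset\widetilde{\mathcal S}^{q-2}_\rho$: $L^{q-2}(N)=\sup\{\widetilde{\bf U}^{q-2}_\rho(C({\bf w};t)): {\bf w}\in\widetilde{\mathcal S}^{q-2}_\rho,\ -1\le t<1,\ N\cap C({\bf w};t)=\emptyset\}$ (largest empty cap discrepancy, LECD); $A^{q-2}(N)=\sup\{\cos^{-1}(t): {\bf w}\in\widetilde{\mathcal S}^{q-2}_\rho,\ -1\le t<1,\ N\cap C({\bf w};t)=\emptyset\}$ (largest empty cap angular discrepancy, LECAD). For $0\le t<1$, $\beta^{q-2}(t)=\frac{\Gamma(\frac{q-1}{2})}{\Gamma(\frac12)\Gamma(\frac{q-2}{2})}\int_t^1(1-v^2)^{\frac q2-2}\,dv$, which equals $\widetilde{\bf U}^{q-2}_\rho(C({\bf w};t))$ for every ${\bf w}\in\widetilde{\mathcal S}^{q-2}_\rho$. *)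

theory Defs
  imports "HOL-Analysis.Analysis" "HOL-Probability.Probability_Measure"
begin

text \<open>
  The space of real column vectors with \<open>q\<close> entries is rendered as \<open>real ^ 'n\<close>
  with \<open>CARD('n) = q\<close>. As the mathematics refers to the order of the components, the index
  type carries a linear order (class \<open>wellorder\<close>, which for a finite type is the same as
  \<open>linorder\<close>, is what the library lemmas on Lebesgue measure of \<open>real ^ 'n\<close>
  require). The index \<open>i\<close> stands for the integer \<open>index i\<close> in \<open>{1..q}\<close>.
\<close>

text \<open>Unlike \<open>real ^ 'n\<close>, the synonym adds no sort constraint of its own to \<open>'n\<close>.\<close>

type_synonym 'n rvec = "(real, 'n) vec"

definition index :: "'n::{finite,wellorder} \<Rightarrow> nat"
  where "index i = card {..i}"

definition mean_zero :: "'n::{finite,wellorder} rvec set"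
  where "mean_zero = {v. v \<bullet> (\<chi> i. 1) = 0}"

definition ascending :: "'n::{finite,wellorder} rvec set"
  where "ascending = {x. \<forall>i j. i \<le> j \<longrightarrow> x $ i \<le> x $ j}"

definition ybar :: "'n::{finite,wellorder} rvec"
  where "ybar = (\<chi> i. real (index i) - (real CARD('n) + 1) / 2)"

definition zvec :: "nat \<Rightarrow> 'n::{finite,wellorder} rvec"
  where "zvec k = (\<chi> i.
    if index i \<le> k
    then - (1 / sqrt (real CARD('n))) * sqrt ((real CARD('n) - real k) / real k)
    else 1 / sqrt (real CARD('n)) * sqrt (real k / (real CARD('n) - real k)))"

definition permutation_matrix :: "real ^ 'n ^ 'n \<Rightarrow> bool"
  where "permutation_matrix P \<longleftrightarrow>
    (\<exists>p. p permutes (UNIV :: 'n set) \<and> P = (\<chi> i j. if j = p i then 1 else 0))"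

definition perm_orbit :: "'n::finite rvec \<Rightarrow> 'n rvec set"
  where "perm_orbit y = {P *v y | P. permutation_matrix P}"

definition msphere :: "real \<Rightarrow> 'n::{finite,wellorder} rvec set"
  where "msphere \<rho> = {v \<in> mean_zero. norm v = \<rho>}"

text \<open>
  Rotations of \<open>mean_zero\<close> are taken to be the linear isometries of that subspace,
  given as restrictions of the linear isometries of the ambient space that map it onto itself.
  (Every isometry of the subspace extends to one of the ambient space.)
\<close>

definition uniform_on_msphere :: "real \<Rightarrow> 'n::{finite,wellorder} rvec measure \<Rightarrow> bool"
  where "uniform_on_msphere \<rho> U \<longleftrightarrow>
    prob_space U \<and> space U = msphere \<rho> \<and> sets U = sets (restrict_space borel (msphere \<rho>)) \<and>
    (\<forall>f. orthogonal_transformation f \<and> f ` mean_zero = mean_zero \<longrightarrow> distr U U f = U)"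

definition cap :: "real \<Rightarrow> 'n::{finite,wellorder} rvec \<Rightarrow> real \<Rightarrow> 'n rvec set"
  where "cap \<rho> w t = {v \<in> msphere \<rho>. v \<bullet> w > \<rho>\<^sup>2 * t}"

definition LECD ::
  "real \<Rightarrow> 'n::{finite,wellorder} rvec measure \<Rightarrow> 'n rvec set \<Rightarrow> real"
  where "LECD \<rho> U N = Sup {measure U (cap \<rho> w t) | w t.
    w \<in> msphere \<rho> \<and> -1 \<le> t \<and> t < 1 \<and> N \<inter> cap \<rho> w t = {}}"

definition LECAD :: "real \<Rightarrow> 'n::{finite,wellorder} rvec set \<Rightarrow> real"
  where "LECAD \<rho> N = Sup {arccos t | w t.
    w \<in> msphere \<rho> \<and> -1 \<le> t \<and> t < 1 \<and> N \<inter> cap \<rho> w t = {}}"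

text \<open>
  With \<open>q\<close> equal to \<open>3\<close> the integrand below is unbounded at \<open>1\<close>; it is
  nonnegative and the Henstock-Kurzweil integral has the value of the improper integral.
\<close>

definition cap_beta :: "nat \<Rightarrow> real \<Rightarrow> real"
  where "cap_beta q t =
    Gamma ((real q - 1) / 2) / (Gamma (1 / 2) * Gamma ((real q - 2) / 2)) *
    integral {t..1} (\<lambda>v. (1 - v\<^sup>2) powr (real q / 2 - 2))"

definition unit_ascending :: "'n::{finite,wellorder} rvec set"
  where "unit_ascending = {z \<in> mean_zero \<inter> ascending. norm z = 1}"

definition min_inner :: "'n::{finite,wellorder} rvec \<Rightarrow> real"
  where "min_inner z = Min ((\<lambda>k. z \<bullet> zvec k) ` {1..CARD('n) - 1})"

text \<open>The type argument fixes the index type; the value depends on \<open>CARD('n)\<close> only.\<close>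

definition Lambda_hat :: "'n::{finite,wellorder} itself \<Rightarrow> real"
  where "Lambda_hat _ = (SUP z \<in> (unit_ascending :: 'n rvec set). min_inner z)"

definition bcoef :: "nat \<Rightarrow> nat \<Rightarrow> real"
  where "bcoef q k = sqrt (3 * real k * (real q - real k) / (real q * (real q + 1)))"

definition ahat :: "'n::{finite,wellorder} rvec"
  where "ahat = (\<chi> i. bcoef CARD('n) (index i - 1) - bcoef CARD('n) (index i))"

definition zhat :: "'n::{finite,wellorder} rvec"
  where "zhat = ahat /\<^sub>R norm (ahat :: 'n rvec)"

definition yhat :: "'n::{finite,wellorder} rvec"
  where "yhat = norm (ybar :: 'n rvec) *\<^sub>R zhat"

text \<open>
  \<open>uniform_on_msphere\<close> is satisfiable: project a uniformly distributed point of the unit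
  ball onto \<open>mean_zero\<close> and rescale it to norm \<open>\<rho>\<close>.
\<close>

definition mproj :: "'n::{finite,wellorder} rvec \<Rightarrow> 'n rvec"
  where "mproj x = x - ((x \<bullet> (\<chi> i. 1)) / real CARD('n)) *\<^sub>R (\<chi> i. 1)"

lemma inner_ones_ones: "((\<chi> i. 1) :: real ^ 'n::finite) \<bullet> (\<chi> i. 1) = real CARD('n)"
  by (simp add: inner_vec_def)

lemma mproj_in: "mproj x \<in> mean_zero"
  by (simp add: mproj_def mean_zero_def inner_diff_left inner_ones_ones)

lemma linear_mproj: "linear mproj"
  unfolding mproj_def
  by (rule linearI) (simp_all add: algebra_simps inner_add_left add_divide_distrib)

lemma mproj_eq_0:
  assumes "\<And>v. v \<in> mean_zero \<Longrightarrow> w \<bullet> v = 0"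
  shows "mproj w = 0"
proof -
  have "mproj w \<bullet> mproj w =
      w \<bullet> mproj w - ((w \<bullet> (\<chi> i. 1)) / real CARD('a)) * (mproj w \<bullet> (\<chi> i. 1))"
    by (subst (1) mproj_def) (simp only: inner_diff_left inner_scaleR_left inner_commute[of "\<chi> i. 1"])
  then have "mproj w \<bullet> mproj w = 0"
    using assms[OF mproj_in] mproj_in[of w] by (simp add: mean_zero_def)
  then show ?thesis by simp
qed

lemma mproj_id: "v \<in> mean_zero \<Longrightarrow> mproj v = v"
  by (simp add: mproj_def mean_zero_def)

lemma mproj_orthogonal_commute:
  fixes f :: "'n::{finite,wellorder} rvec \<Rightarrow> 'n rvec"
  assumes f: "orthogonal_transformation f" and im: "f ` mean_zero = mean_zero"
  shows "mproj (f x) = f (mproj x)"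
proof -
  have lf: "linear f" using f by (rule orthogonal_transformation_linear)
  have perp: "(x - mproj x) \<bullet> u = 0" if "u \<in> mean_zero" for u
    using that by (simp add: mproj_def mean_zero_def inner_commute)
  have "mproj (f (x - mproj x)) = 0"
  proof (rule mproj_eq_0)
    fix v :: "'n rvec" assume "v \<in> mean_zero"
    then obtain u where "u \<in> mean_zero" "v = f u" using im by blast
    then show "f (x - mproj x) \<bullet> v = 0"
      using f perp by (simp add: orthogonal_transformation_def)
  qed
  then have "mproj (f x) = mproj (f (mproj x))"
    by (simp add: linear_diff[OF lf] linear_diff[OF linear_mproj])
  also have "\<dots> = f (mproj x)"
    using im mproj_in by (intro mproj_id) blast
  finally show ?thesis .
qed

lemma mean_zero_nontrivial:
  assumes "CARD('n::{finite,wellorder}) \<ge> 2"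
  obtains v :: "'n::{finite,wellorder} rvec" where "v \<in> mean_zero" "v \<noteq> 0"
proof -
  obtain i j :: 'n where ij: "i \<noteq> j"
    using assms by (metis card_le_Suc0_iff_eq finite not_less_eq_eq numeral_2_eq_2)
  define v :: "'n rvec" where "v = axis i 1 - axis j 1"
  have "v \<in> mean_zero"
    by (simp add: v_def mean_zero_def inner_diff_left inner_axis')
  moreover have "v \<noteq> 0" using ij by (auto simp: v_def axis_eq_axis)
  ultimately show ?thesis by (rule that)
qed

lemma uniform_on_msphere_exists:
  assumes q: "CARD('n::{finite,wellorder}) \<ge> 2" and \<rho>: "\<rho> > 0"
  shows "\<exists>U :: 'n::{finite,wellorder} rvec measure. uniform_on_msphere \<rho> U"
proof -
  obtain v0 :: "'n rvec" where v0: "v0 \<in> mean_zero" "v0 \<noteq> 0"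
    using mean_zero_nontrivial[OF q] .
  let ?R = "restrict_space borel (msphere \<rho>) :: 'n rvec measure"
  define s where "s = (\<rho> / norm v0) *\<^sub>R v0"
  define B :: "'n rvec set" where "B = ball 0 1 \<inter> {x. mproj x \<noteq> 0}"
  define g where "g x = (if mproj x = 0 then s else (\<rho> / norm (mproj x)) *\<^sub>R mproj x)" for x :: "'n rvec"
  have cont: "continuous_on S (mproj :: 'n rvec \<Rightarrow> _)" for S
    using linear_mproj linear_continuous_on linear_conv_bounded_linear by blast
  have opB: "open B"
    unfolding B_def by (intro open_Int open_ball open_Collect_neq cont continuous_intros)
  have "(1 / (2 * norm v0)) *\<^sub>R v0 \<in> B"
    using v0 by (simp add: B_def linear_scale[OF linear_mproj] mproj_id)
  then have neB: "B \<noteq> {}" by blast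
  have lmB: "B \<in> lmeasurable"
    using opB by (intro lmeasurable_open) (auto simp: B_def intro: bounded_subset[OF bounded_ball])
  have Bborel: "B \<in> sets borel" using opB by simp
  have eB0: "emeasure lborel B \<noteq> 0"
    using opB neB open_not_negligible[of B] Bborel
    by (auto simp: negligible_iff_null_sets null_sets_def)
  have eBinf: "emeasure lborel B \<noteq> \<infinity>"
    using lmB Bborel by (auto simp: fmeasurable_def)
  let ?L = "uniform_measure lborel B"
  interpret L: prob_space ?L
    using eB0 eBinf by (rule prob_space_uniform_measure)
  have ms: "mproj \<in> borel_measurable (borel :: 'n rvec measure)"
    using cont by (rule borel_measurable_continuous_onI)
  have gS: "g x \<in> msphere \<rho>" for x
    using \<rho> v0 mproj_in[of x] by (auto simp: g_def s_def msphere_def mean_zero_def)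
  have gb: "g \<in> borel \<rightarrow>\<^sub>M borel"
    unfolding g_def using ms by measurable
  have gm: "g \<in> ?L \<rightarrow>\<^sub>M ?R"
    using gS gb by (auto intro!: measurable_restrict_space2)
  define U where "U = distr ?L ?R g"
  have spU: "space U = msphere \<rho>" by (simp add: U_def space_restrict_space)
  have stU: "sets U = sets ?R" by (simp add: U_def)
  have inv: "distr U U f = U"
    if f: "orthogonal_transformation f" and im: "f ` mean_zero = mean_zero" for f
  proof (rule measure_eqI)
    show "sets (distr U U f) = sets U" by simp
    fix A assume "A \<in> sets (distr U U f)"
    then have A: "A \<in> sets ?R" by (simp add: stU)
    have lf: "linear f" using f by (rule orthogonal_transformation_linear)
    have bij: "bij f" using f by (rule orthogonal_transformation_bij)
    have fc: "f \<in> borel \<rightarrow>\<^sub>M borel"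
      using lf by (intro borel_measurable_continuous_onI linear_continuous_on)
        (simp add: linear_conv_bounded_linear)
    have fS: "f x \<in> msphere \<rho>" if "x \<in> msphere \<rho>" for x
      using that im f by (auto simp: msphere_def orthogonal_transformation_norm)
    have fm: "f \<in> ?R \<rightarrow>\<^sub>M ?R"
      using fS fc by (auto intro!: measurable_restrict_space3)
    have fU: "f \<in> U \<rightarrow>\<^sub>M U"
      using fm by (simp add: stU cong: measurable_cong_sets)
    have f0: "f y = 0 \<longleftrightarrow> y = 0" for y
      using f by (metis norm_eq_zero orthogonal_transformation_norm)
    have fB: "f x \<in> B \<longleftrightarrow> x \<in> B" for x
      using f by (simp add: B_def mproj_orthogonal_commute[OF f im] f0
          orthogonal_transformation_norm[OF f])
    have gf: "g (f x) = f (g x)" if "x \<in> B" for x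
      using that by (simp add: g_def B_def mproj_orthogonal_commute[OF f im] f0
          orthogonal_transformation_norm[OF f] linear_scale[OF lf])
    have val: "emeasure U C = emeasure lborel (B \<inter> g -` C) / emeasure lborel B"
      if C: "C \<in> sets ?R" for C
    proof -
      have gC: "g -` C \<in> sets borel"
        using measurable_sets[OF gm C] by simp
      have "emeasure U C = emeasure ?L (g -` C)"
        unfolding U_def using C gm by (subst emeasure_distr) auto
      then show ?thesis using Bborel gC by simp
    qed
    have pre: "f -` A \<inter> space U \<in> sets ?R"
      using measurable_sets[OF fU, of A] A stU by simp
    have "B \<inter> g -` A = f ` (B \<inter> g -` (f -` A \<inter> space U))" (is "?X = f ` ?Y")
    proof (intro equalityI subsetI)
      fix y assume y: "y \<in> ?X"
      obtain x where x: "y = f x" using bij by (metis bij_pointE)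
      then have "x \<in> B" using y fB by simp
      then have "x \<in> ?Y" using y x gf[of x] gS by (auto simp: spU)
      then show "y \<in> f ` ?Y" using x by blast
    next
      fix y assume "y \<in> f ` ?Y"
      then show "y \<in> ?X" using fB gf by auto
    qed
    moreover have Yb: "?Y \<in> sets borel"
      using measurable_sets[OF gm pre] Bborel by auto
    moreover have Xb: "?X \<in> sets borel"
      using measurable_sets[OF gm A] Bborel by auto
    moreover have Yl: "?Y \<in> lmeasurable"
      using Yb lmB by (intro fmeasurableI2[OF lmB]) auto
    moreover have Xl: "?X \<in> lmeasurable"
      using Xb lmB by (intro fmeasurableI2[OF lmB]) auto
    ultimately have "measure lebesgue ?X = measure lebesgue ?Y"
      using measure_orthogonal_image[OF f Yl] by simp
    then have "emeasure lebesgue ?X = emeasure lebesgue ?Y"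
      using Xl Yl by (simp add: emeasure_eq_measure2)
    then have "emeasure lborel ?X = emeasure lborel ?Y"
      using Xb Yb by simp
    then have "emeasure U (f -` A \<inter> space U) = emeasure U A"
      using val[OF A] val[OF pre] by simp
    then show "emeasure (distr U U f) A = emeasure U A"
      using fU A stU by (simp add: emeasure_distr)
  qed
  have "prob_space U" unfolding U_def using gm by (rule L.prob_space_distr)
  then have "uniform_on_msphere \<rho> U"
    using spU stU inv by (simp add: uniform_on_msphere_def)
  then show ?thesis ..
qed

end

(* A point z of the cone of ascending mean-zero vectors is a nonnegative combination of the zvec k
   (summation by parts), and ahat has the same inner product with every zvec k; so ahat is a positive
   combination of the zvec k, and the smallest inner product of a unit vector z with them is at most
   a multiple of z . zhat. Sorting w shows that an empty cap of the orbit of z has threshold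
   at least min_inner z, and the caps around the zvec k attain this.

   The measure of a cap comes from the moments of v . e for a uniform v: the rotation invariance along
   e + s b, at second order in s, gives a recurrence for the even moments. It is that of the
   Beta(1/2, (q - 2)/2) distribution, which is the law of the normalised (v . e)^2 as
   its support is bounded. *)

theory Submission
  imports Defs "HOL-Probability.Probability"
begin

section \<open>The cone of ascending vectors\<close>

text \<open>For a mean-zero vector, the inner product with \<open>zvec k\<close> is its k-th partial
  sum divided by -sqrt (k (q - k) / q). Equal inner products for all k therefore force partial sums
  proportional to -sqrt (k (q - k)). This is the origin of \<open>bcoef\<close>, and its factor sqrt
  (3 / (q + 1)) is the common value of the inner products of \<open>ahat\<close>. Ascending vectors
  have \<open>min_inner\<close> at least 0, so no cap larger than a hemisphere is ever empty. For
  the remaining caps, measure and angle both decrease strictly in the threshold, so both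
  discrepancies are minimized by maximizing the single number \<open>min_inner\<close>. The obstacle
  is that \<open>U\<close> is known only through its invariance: there is no density or
  parametrization to integrate. Only moments along fixed directions can be compared. Squaring the
  coordinate places its law on [0,1], where moments determine a distribution; the lost sign is
  recovered from the symmetry between opposite caps.\<close>

lemma index_less_iff: "index i < index j \<longleftrightarrow> (i::'n::{finite,wellorder}) < j"
proof -
  have "index a < index b" if "a < b" for a b :: 'n
    unfolding index_def using that by (intro psubset_card_mono) auto
  then show ?thesis by (metis less_asym linorder_less_linear)
qed

lemma index_le_iff: "index i \<le> index j \<longleftrightarrow> (i::'n::{finite,wellorder}) \<le> j"
  by (metis index_less_iff linorder_not_less)

lemma bij_betw_index: "bij_betw index (UNIV :: 'n::{finite,wellorder} set) {1..CARD('n)}"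
proof -
  have inj: "inj (index :: 'n \<Rightarrow> nat)"
    by (metis injI index_le_iff order_antisym order_refl)
  have "range (index :: 'n \<Rightarrow> nat) \<subseteq> {1..CARD('n)}"
    using card_mono[OF finite subset_UNIV] by (auto simp: index_def Suc_le_eq card_gt_0_iff)
  then have "range (index :: 'n \<Rightarrow> nat) = {1..CARD('n)}"
    by (intro card_subset_eq) (auto simp: card_image[OF inj])
  then show ?thesis using inj by (simp add: bij_betw_def)
qed

definition unindex :: "nat \<Rightarrow> 'n::{finite,wellorder}"
  where "unindex = inv_into UNIV index"

lemma unindex_index [simp]: "unindex (index i) = i"
  unfolding unindex_def using bij_betw_index by (metis bij_betw_imp_inj_on inv_f_f)

lemma index_unindex [simp]:
  "k \<in> {1..CARD('n)} \<Longrightarrow> index (unindex k :: 'n::{finite,wellorder}) = k"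
  unfolding unindex_def using bij_betw_index[where 'n='n]
  by (metis bij_betw_imp_surj_on f_inv_into_f)

lemma index_bounds: "1 \<le> index (i::'n::{finite,wellorder})" "index i \<le> CARD('n)"
  using bij_betw_index[where 'n='n] by (auto simp: bij_betw_def)

lemma sum_unindex:
  "(\<Sum>i\<in>UNIV. f (i :: 'n::{finite,wellorder})) = (\<Sum>k=1..CARD('n). f (unindex k))"
  by (subst sum.reindex_bij_betw[OF bij_betw_index, symmetric]) simp

lemma sum_index_le_unindex:
  assumes "k \<le> CARD('n)"
  shows "(\<Sum>i | index i \<le> k. f (i :: 'n::{finite,wellorder})) = (\<Sum>j=1..k. f (unindex j))"
proof -
  have "(\<Sum>i | index i \<le> k. f i) = (\<Sum>i\<in>UNIV. if index i \<le> k then f (i::'n) else 0)"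
    by (subst sum.If_cases) auto
  also have "\<dots> = (\<Sum>j=1..CARD('n). if j \<le> k then f (unindex j) else 0)"
    by (subst sum_unindex) (intro sum.cong; simp)
  also have "\<dots> = (\<Sum>j=1..k. f (unindex j))"
    using assms by (intro sum.mono_neutral_cong_right) auto
  finally show ?thesis .
qed

lemma card_index_le: "k \<le> CARD('n) \<Longrightarrow> card {i :: 'n::{finite,wellorder}. index i \<le> k} = k"
  using sum_index_le_unindex[of k "\<lambda>_::'n. 1::nat"] by simp

section \<open>Partial sums, and expansion of the cone in the step vectors
  \<open>zvec k\<close>\<close>

lemma summation_by_parts:
  fixes f g :: "nat \<Rightarrow> 'a::comm_ring"
  shows "(\<Sum>k=1..Suc n. f k * g k) =
    g (Suc n) * (\<Sum>k=1..Suc n. f k) - (\<Sum>k=1..n. (g (Suc k) - g k) * (\<Sum>j=1..k. f j))"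
  by (induction n) (simp_all add: algebra_simps)

lemma mean_zero_sum: "z \<in> mean_zero \<longleftrightarrow> (\<Sum>i\<in>UNIV. z $ i) = 0"
  by (simp add: mean_zero_def inner_vec_def)

text \<open>\<open>zvec k\<close> takes two values \<open>a\<close> and \<open>b\<close>, and the
  two blocks of a mean-zero vector have opposite sums \<open>S\<close> and \<open>- S\<close>. Hence
  the inner product is \<open>S * (a - b)\<close>, and the square root on the left is the reciprocal
  of the jump \<open>b - a\<close>.\<close>

lemma inner_zvec:
  assumes z: "(z :: 'n::{finite,wellorder} rvec) \<in> mean_zero" and k: "k \<in> {1..<CARD('n)}"
  shows "sqrt (real k * (real CARD('n) - real k) / real CARD('n)) * (z \<bullet> zvec k) =
    - (\<Sum>i | index i \<le> k. z $ i)"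
proof -
  define q where "q = real CARD('n)"
  define r where "r = real k"
  have qr: "0 < r" "r < q" using k by (auto simp: q_def r_def)
  define S where "S = (\<Sum>i | index i \<le> k. z $ i)"
  have split: "(\<Sum>i\<in>UNIV. z $ i) = S + (\<Sum>i | \<not> index i \<le> k. z $ i)"
    unfolding S_def by (subst sum.union_disjoint[symmetric]) (auto intro: sum.cong)
  have C: "(\<Sum>i | \<not> index i \<le> k. z $ i) = - S"
    using z split by (simp add: mean_zero_sum)
  define a where "a = - (1 / sqrt q) * sqrt ((q - r) / r)"
  define b where "b = 1 / sqrt q * sqrt (r / (q - r))"
  have "z \<bullet> zvec k = (\<Sum>i\<in>UNIV. if index i \<le> k then z $ i * a else z $ i * b)"
    unfolding inner_vec_def zvec_def a_def b_def q_def r_def by (intro sum.cong) auto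
  also have "\<dots> = S * a + (- S) * b"
    by (subst sum.If_cases)
      (simp_all only: finite sum_distrib_right[symmetric] C S_def[symmetric] Collect_neg_eq[symmetric] Int_UNIV_left)
  finally have E: "z \<bullet> zvec k = S * a - S * b" by simp
  define s where "s = sqrt (r * (q - r) / q)"
  have "(q - r) / q = 1 - r / q" using qr by (simp add: diff_divide_distrib)
  moreover have "s * a = - ((q - r) / q)"
    using qr by (simp add: s_def a_def real_sqrt_mult real_sqrt_divide)
  moreover have "s * b = r / q"
    using qr by (simp add: s_def b_def real_sqrt_mult real_sqrt_divide)
  moreover have "s * (z \<bullet> zvec k) = S * (s * a) - S * (s * b)"
    unfolding E by (simp add: algebra_simps)
  ultimately have "s * (z \<bullet> zvec k) = S * (- (1 - r / q)) - S * (r / q)" by simp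
  also have "\<dots> = - S" by (simp add: right_diff_distrib)
  finally show ?thesis by (simp add: s_def q_def r_def S_def)
qed

text \<open>The coefficient of \<open>zvec k\<close> in the expansion of the mean-zero part of
  \<open>w\<close>: the jump of \<open>w\<close> after position k, divided by the only jump of
  \<open>zvec k\<close>.\<close>

definition cone_coeff :: "'n::{finite,wellorder} rvec \<Rightarrow> nat \<Rightarrow> real"
  where "cone_coeff w k = (w $ unindex (Suc k) - w $ unindex k) *
    sqrt (real k * (real CARD('n) - real k) / real CARD('n))"

text \<open>Summation by parts puts differences on \<open>w\<close> and partial sums on
  \<open>z\<close>. The boundary term vanishes because \<open>z\<close> has sum 0, and the partial
  sums are the inner products with the \<open>zvec k\<close> up to scale. This is the expansion of
  \<open>w\<close> in weak form, tested against mean-zero vectors.\<close>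

lemma inner_cone_coeff:
  assumes z: "(z :: 'n::{finite,wellorder} rvec) \<in> mean_zero"
  shows "z \<bullet> w = (\<Sum>k\<in>{1..<CARD('n)}. cone_coeff w k * (z \<bullet> zvec k))"
proof -
  obtain n where n: "CARD('n) = Suc n" by (metis card_eq_0_iff finite UNIV_not_empty not0_implies_Suc)
  have "z \<bullet> w = (\<Sum>k=1..Suc n. z $ unindex k * w $ unindex k)"
    by (simp add: inner_vec_def sum_unindex n)
  also have "\<dots> = w $ unindex (Suc n) * (\<Sum>k=1..Suc n. z $ unindex k)
      - (\<Sum>k=1..n. (w $ unindex (Suc k) - w $ unindex k) * (\<Sum>j=1..k. z $ unindex j))"
    by (rule summation_by_parts)
  also have "(\<Sum>k=1..Suc n. z $ unindex k) = 0"
    using z by (simp only: mean_zero_sum sum_unindex n)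
  also have "w $ unindex (Suc n) * 0
      - (\<Sum>k=1..n. (w $ unindex (Suc k) - w $ unindex k) * (\<Sum>j=1..k. z $ unindex j)) =
      (\<Sum>k=1..n. (w $ unindex (Suc k) - w $ unindex k) * (- (\<Sum>j=1..k. z $ unindex j)))"
    by (simp add: sum_negf)
  also have "\<dots> = (\<Sum>k\<in>{1..<CARD('n)}. cone_coeff w k * (z \<bullet> zvec k))"
  proof (rule sum.cong)
    show "{1..n} = {1..<CARD('n)}" using n by auto
    fix k assume "k \<in> {1..<CARD('n)}"
    then show "(w $ unindex (Suc k) - w $ unindex k) * (- (\<Sum>j=1..k. z $ unindex j)) =
        cone_coeff w k * (z \<bullet> zvec k)"
      using inner_zvec[OF z, of k] by (simp add: cone_coeff_def mult.assoc sum_index_le_unindex)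
  qed
  finally show ?thesis .
qed

lemma cone_coeff_nonneg:
  assumes "(w :: 'n::{finite,wellorder} rvec) \<in> ascending" "k \<in> {1..<CARD('n)}"
  shows "0 \<le> cone_coeff w k"
proof -
  have "index (unindex k :: 'n) \<le> index (unindex (Suc k) :: 'n)" using assms(2) by simp
  then have "w $ unindex k \<le> w $ unindex (Suc k)"
    using assms(1) unfolding index_le_iff ascending_def by blast
  then show ?thesis using assms(2) by (simp add: cone_coeff_def)
qed

lemma zvec_unit_ascending:
  assumes k: "k \<in> {1..<CARD('n)}"
  shows "(zvec k :: 'n::{finite,wellorder} rvec) \<in> unit_ascending"
proof -
  define q where "q = real CARD('n)"
  define r where "r = real k"
  have qr: "0 < r" "r < q" using k by (auto simp: q_def r_def)
  define a where "a = - (1 / sqrt q) * sqrt ((q - r) / r)"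
  define b where "b = 1 / sqrt q * sqrt (r / (q - r))"
  have ab: "a \<le> b" 
    using qr by (auto simp: a_def b_def intro: order_trans[of _ 0])
  have Z: "(zvec k :: 'n rvec) = (\<chi> i. if index i \<le> k then a else b)"
    unfolding zvec_def a_def b_def q_def r_def ..
  have c1: "card {i::'n. index i \<le> k} = k" using k by (intro card_index_le) auto
  have c2: "card (- {i::'n. index i \<le> k}) = CARD('n) - k"
    by (simp add: Compl_eq_Diff_UNIV card_Diff_subset c1)
  have cnt: "(\<Sum>i\<in>UNIV. if index (i::'n) \<le> k then x else y) = r * x + (q - r) * y" for x y :: real
    using k by (subst sum.If_cases) (simp_all add: c1 c2 q_def r_def of_nat_diff)
  have s1: "r * sqrt ((q - r) / r) = sqrt r * sqrt (q - r)"
    using qr by (simp add: real_sqrt_divide field_simps)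
  have s2: "(q - r) * sqrt (r / (q - r)) = sqrt r * sqrt (q - r)"
    using qr by (simp add: real_sqrt_divide field_simps)
  have "r * a = - (1 / sqrt q) * (r * sqrt ((q - r) / r))"
    and "(q - r) * b = 1 / sqrt q * ((q - r) * sqrt (r / (q - r)))"
    by (simp_all only: a_def b_def mult.left_commute)
  then have "r * a + (q - r) * b = 0" unfolding s1 s2 by simp
  then have m: "(zvec k :: 'n rvec) \<in> mean_zero"
    by (simp add: mean_zero_sum Z cnt)
  have a2: "a\<^sup>2 = (q - r) / (q * r)" and b2: "b\<^sup>2 = r / (q * (q - r))"
    using qr by (simp_all add: a_def b_def power_mult_distrib power_divide)
  have "(zvec k :: 'n rvec) \<bullet> zvec k = (\<Sum>i\<in>UNIV. if index (i::'n) \<le> k then a\<^sup>2 else b\<^sup>2)"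
    unfolding inner_vec_def Z by (intro sum.cong) (auto simp: power2_eq_square)
  also have "\<dots> = 1" using qr unfolding cnt a2 b2 by (simp add: field_simps)
  finally have "norm (zvec k :: 'n rvec) = 1" by (simp add: norm_eq_1)
  moreover have "(zvec k :: 'n rvec) \<in> ascending"
  proof -
    have "index i \<le> k" if "i \<le> j" "index j \<le> k" for i j :: 'n
      using that index_le_iff[of i j] by linarith
    then show ?thesis using ab by (auto simp: Z ascending_def)
  qed
  ultimately show ?thesis using m by (simp add: unit_ascending_def)
qed

lemma min_inner_le: "k \<in> {1..<CARD('n)} \<Longrightarrow> min_inner (z :: 'n::{finite,wellorder} rvec) \<le> z \<bullet> zvec k"
  unfolding min_inner_def by (intro Min_le) auto

lemma min_inner_attained:
  assumes "CARD('n::{finite,wellorder}) \<ge> 2"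
  obtains k where "k \<in> {1..<CARD('n)}" "min_inner (z :: 'n rvec) = z \<bullet> zvec k"
proof -
  have "min_inner z \<in> (\<lambda>k. z \<bullet> zvec k) ` {1..CARD('n) - 1}"
    unfolding min_inner_def using assms by (intro Min_in) auto
  then show ?thesis using assms by (auto intro!: that)
qed

text \<open>The minimum of a linear functional over the spherical simplex is attained at a vertex, as
  unit vectors of the cone have coefficient sum at least \<open>1\<close>.\<close>

lemma min_inner_le_inner:
  fixes z w :: "'n::{finite,wellorder} rvec"
  assumes z: "z \<in> mean_zero" and w: "w \<in> unit_ascending" and nn: "0 \<le> min_inner z"
  shows "min_inner z \<le> z \<bullet> w"
proof -
  have w': "w \<in> mean_zero" "w \<in> ascending" "norm w = 1" using w by (auto simp: unit_ascending_def)
  have "1 = w \<bullet> w" using w' by (simp add: norm_eq_1)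
  also have "\<dots> = (\<Sum>k\<in>{1..<CARD('n)}. cone_coeff w k * (w \<bullet> zvec k))"
    by (rule inner_cone_coeff[OF w'(1)])
  also have "\<dots> \<le> (\<Sum>k\<in>{1..<CARD('n)}. cone_coeff w k * 1)"
  proof (intro sum_mono mult_left_mono cone_coeff_nonneg w')
    fix k assume "k \<in> {1..<CARD('n)}"
    then have "norm (zvec k :: 'n rvec) = 1"
      using zvec_unit_ascending[where 'n='n] by (simp add: unit_ascending_def)
    then show "w \<bullet> zvec k \<le> 1" using norm_cauchy_schwarz[of w "zvec k"] w' by simp
  qed
  finally have "min_inner z * 1 \<le> min_inner z * (\<Sum>k\<in>{1..<CARD('n)}. cone_coeff w k)"
    using nn by (intro mult_left_mono) simp_all
  also have "\<dots> \<le> (\<Sum>k\<in>{1..<CARD('n)}. cone_coeff w k * (z \<bullet> zvec k))"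
    unfolding sum_distrib_left
    by (intro sum_mono) (simp add: mult.commute[of "min_inner z"] mult_left_mono cone_coeff_nonneg w' min_inner_le)
  also have "\<dots> = z \<bullet> w" by (rule inner_cone_coeff[OF z, symmetric])
  finally show ?thesis by simp
qed

section \<open>The vector \<open>ahat\<close> and the optimality of \<open>zhat\<close>\<close>

lemma ahat_unindex:
  "k \<in> {1..CARD('n)} \<Longrightarrow>
    (ahat :: 'n::{finite,wellorder} rvec) $ unindex k = bcoef CARD('n) (k - 1) - bcoef CARD('n) k"
  by (simp add: ahat_def)

text \<open>The entries are differences of \<open>bcoef\<close>, so the sum telescopes, and
  \<open>bcoef\<close> vanishes at 0. As it also vanishes at q, \<open>ahat\<close> is
  mean-zero.\<close>

lemma sum_ahat:
  assumes "k \<le> CARD('n)"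
  shows "(\<Sum>i | index i \<le> k. (ahat :: 'n::{finite,wellorder} rvec) $ i) = - bcoef CARD('n) k"
proof -
  have "(\<Sum>i | index i \<le> k. (ahat :: 'n rvec) $ i) =
      (\<Sum>j=1..k. bcoef CARD('n) (j - 1) - bcoef CARD('n) j)"
    unfolding sum_index_le_unindex[OF assms] using assms by (intro sum.cong) (auto simp: ahat_unindex)
  also have "\<dots> = - bcoef CARD('n) k"
    by (induction k) (simp_all add: bcoef_def)
  finally show ?thesis .
qed

lemma ahat_mean_zero: "(ahat :: 'n::{finite,wellorder} rvec) \<in> mean_zero"
proof -
  have "{i :: 'n. index i \<le> CARD('n)} = UNIV" using index_bounds by auto
  then show ?thesis
    using sum_ahat[where 'n='n, of "CARD('n)"] by (simp add: mean_zero_sum bcoef_def)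
qed

text \<open>The factor in \<open>inner_zvec\<close> cancels against the dependence of
  \<open>bcoef\<close> on k; this cancellation is what \<open>bcoef\<close> is made for.\<close>

lemma ahat_inner_zvec:
  assumes k: "k \<in> {1..<CARD('n)}"
  shows "(ahat :: 'n::{finite,wellorder} rvec) \<bullet> zvec k = sqrt (3 / (real CARD('n) + 1))"
proof -
  define s where "s = sqrt (real k * (real CARD('n) - real k) / real CARD('n))"
  have s: "s > 0" using k by (auto simp: s_def)
  have "s * ((ahat :: 'n rvec) \<bullet> zvec k) = bcoef CARD('n) k"
    using inner_zvec[OF ahat_mean_zero k] sum_ahat[where 'n='n, of k] k by (simp add: s_def)
  also have "\<dots> = s * sqrt (3 / (real CARD('n) + 1))"
    by (simp add: bcoef_def s_def real_sqrt_mult[symmetric] mult_ac)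
  finally show ?thesis using s by simp
qed

text \<open>Concavity and monotonicity of the square root in one inequality, from (a + b)^2 \<le> 2
  (a^2 + b^2).\<close>

lemma sqrt_midpoint_concave:
  assumes "0 \<le> x" "0 \<le> y" "x + y \<le> 2 * z"
  shows "sqrt x + sqrt y \<le> 2 * sqrt z"
proof (rule power2_le_imp_le)
  have "(sqrt x + sqrt y)\<^sup>2 \<le> 2 * ((sqrt x)\<^sup>2 + (sqrt y)\<^sup>2)"
    using sum_squares_bound[of "sqrt x" "sqrt y"] by (simp add: power2_sum)
  also have "\<dots> \<le> (2 * sqrt z)\<^sup>2" using assms by (simp add: power_mult_distrib)
  finally show "(sqrt x + sqrt y)\<^sup>2 \<le> (2 * sqrt z)\<^sup>2" .
qed (use assms in auto)

text \<open>The square root is increasing and concave, and k (q - k) is concave in k. Concavity of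
  \<open>bcoef\<close> says that its successive decrements, which are the entries of
  \<open>ahat\<close>, increase.\<close>

lemma bcoef_concave:
  assumes "1 \<le> k" "k < q"
  shows "bcoef q (k - 1) + bcoef q (Suc k) \<le> 2 * bcoef q k"
  unfolding bcoef_def
proof (rule sqrt_midpoint_concave)
  define r where "r = real k"
  define Q where "Q = real q"
  have r: "real (k - 1) = r - 1" "real (Suc k) = r + 1" "1 \<le> r" "r + 1 \<le> Q"
    using assms by (auto simp: r_def Q_def)
  show "0 \<le> 3 * real (k - 1) * (real q - real (k - 1)) / (real q * (real q + 1))"
    "0 \<le> 3 * real (Suc k) * (real q - real (Suc k)) / (real q * (real q + 1))"
    using assms by auto
  have "3 * (r - 1) * (Q - (r - 1)) + 3 * (r + 1) * (Q - (r + 1)) \<le> 2 * (3 * r * (Q - r))"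
    by (simp add: algebra_simps)
  then have "(3 * (r - 1) * (Q - (r - 1)) + 3 * (r + 1) * (Q - (r + 1))) / (Q * (Q + 1))
      \<le> 2 * (3 * r * (Q - r)) / (Q * (Q + 1))"
    using r by (intro divide_right_mono) auto
  then show "3 * real (k - 1) * (real q - real (k - 1)) / (real q * (real q + 1)) +
      3 * real (Suc k) * (real q - real (Suc k)) / (real q * (real q + 1))
      \<le> 2 * (3 * real k * (real q - real k) / (real q * (real q + 1)))"
    unfolding r r_def[symmetric] Q_def[symmetric] by (simp add: add_divide_distrib)
qed

lemma ahat_ascending: "(ahat :: 'n::{finite,wellorder} rvec) \<in> ascending"
proof -
  have "(ahat :: 'n rvec) $ unindex k \<le> (ahat :: 'n rvec) $ unindex l" if "1 \<le> k" "k \<le> l" "l \<le> CARD('n)" for k l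
    using that(2,3)
  proof (induction rule: dec_induct)
    case (step m)
    then have "(ahat :: 'n rvec) $ unindex k \<le> (ahat :: 'n rvec) $ unindex m" by simp
    also have "\<dots> \<le> (ahat :: 'n rvec) $ unindex (Suc m)"
      using step that(1) bcoef_concave[of m "CARD('n)"] by (simp add: ahat_unindex)
    finally show ?case .
  qed simp
  from this[OF index_bounds(1) _ index_bounds(2)]
  have "(ahat :: 'n rvec) $ i \<le> ahat $ j" if "i \<le> j" for i j
    using that unfolding index_le_iff[symmetric] by (metis unindex_index)
  then show ?thesis by (simp add: ascending_def)
qed

lemma min_inner_eqI:
  assumes "CARD('n) \<ge> 2" and "\<And>k. k \<in> {1..<CARD('n)} \<Longrightarrow> (z :: 'n::{finite,wellorder} rvec) \<bullet> zvec k = c"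
  shows "min_inner z = c"
  using min_inner_attained[OF assms(1), of z] assms(2) by metis

lemma norm_ahat_pos:
  assumes "CARD('n) \<ge> 2"
  shows "0 < norm (ahat :: 'n::{finite,wellorder} rvec)"
  using ahat_inner_zvec[where 'n='n, of 1] assms by auto

lemma zhat_unit_ascending:
  assumes "CARD('n) \<ge> 2"
  shows "(zhat :: 'n::{finite,wellorder} rvec) \<in> unit_ascending"
  using norm_ahat_pos[OF assms] ahat_mean_zero[where 'n='n] ahat_ascending[where 'n='n]
  by (auto simp: unit_ascending_def zhat_def mean_zero_def ascending_def intro: mult_left_mono)

lemma min_inner_zhat:
  assumes "CARD('n) \<ge> 2"
  shows "min_inner (zhat :: 'n::{finite,wellorder} rvec) =
    1 / norm (ahat :: 'n rvec) * sqrt (3 / (real CARD('n) + 1))"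
  using assms by (intro min_inner_eqI) (simp_all add: zhat_def ahat_inner_zvec field_simps)

text \<open>A duality argument. Weighting the bounds \<open>min_inner z\<close> \<le>
  \<open>z \<bullet> zvec k\<close> with the nonnegative coefficients of \<open>ahat\<close> gives
  \<open>min_inner z * D\<close> \<le> \<open>z \<bullet> ahat\<close>. For \<open>z = ahat\<close>
  all these inner products equal \<open>c\<close>, so the same expansion yields
  \<open>N\<^sup>2 = c * D\<close>, which eliminates \<open>D\<close>. The bound holds on the whole
  mean-zero space, not only on the cone.\<close>

lemma min_inner_le_inner_zhat:
  fixes z :: "'n::{finite,wellorder} rvec"
  assumes q: "CARD('n) \<ge> 2" and z: "z \<in> mean_zero"
  shows "min_inner z \<le> min_inner (zhat :: 'n rvec) * (z \<bullet> zhat)"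
proof -
  define c where "c = sqrt (3 / (real CARD('n) + 1))"
  define D where "D = (\<Sum>k\<in>{1..<CARD('n)}. cone_coeff (ahat :: 'n rvec) k)"
  define N where "N = norm (ahat :: 'n rvec)"
  have c: "c > 0" by (simp add: c_def)
  have N: "N > 0" using norm_ahat_pos[OF q] by (simp add: N_def)
  have "N\<^sup>2 = (ahat :: 'n rvec) \<bullet> ahat" by (simp add: N_def dot_square_norm)
  also have "\<dots> = c * D"
    unfolding inner_cone_coeff[OF ahat_mean_zero, of ahat] D_def sum_distrib_left
    by (intro sum.cong) (simp_all add: ahat_inner_zvec c_def)
  finally have N2: "N\<^sup>2 = c * D" .
  have "min_inner z * D = (\<Sum>k\<in>{1..<CARD('n)}. cone_coeff (ahat :: 'n rvec) k * min_inner z)"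
    by (simp add: D_def sum_distrib_left mult.commute)
  also have "\<dots> \<le> (\<Sum>k\<in>{1..<CARD('n)}. cone_coeff (ahat :: 'n rvec) k * (z \<bullet> zvec k))"
    by (intro sum_mono mult_left_mono cone_coeff_nonneg ahat_ascending min_inner_le)
  also have "\<dots> = z \<bullet> ahat" by (rule inner_cone_coeff[OF z, symmetric])
  finally have "c * (min_inner z * D) \<le> c * (z \<bullet> ahat)" using c by (intro mult_left_mono) auto
  then have "min_inner z * N\<^sup>2 \<le> c * (z \<bullet> ahat)" by (simp add: N2 mult_ac)
  then have "min_inner z \<le> c * (z \<bullet> ahat) / N\<^sup>2" using N by (simp add: pos_le_divide_eq)
  also have "\<dots> = min_inner (zhat :: 'n rvec) * (z \<bullet> zhat)"
    unfolding min_inner_zhat[OF q] c_def[symmetric] N_def[symmetric]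
    by (simp add: zhat_def N_def[symmetric] power2_eq_square field_simps)
  finally show ?thesis .
qed

lemma min_inner_zhat_pos: "CARD('n) \<ge> 2 \<Longrightarrow> 0 < min_inner (zhat :: 'n::{finite,wellorder} rvec)"
  using norm_ahat_pos[where 'n='n] by (simp add: min_inner_zhat)

text \<open>Strictness, and with it uniqueness, is the equality case of Cauchy-Schwarz: two unit
  vectors with inner product 1 coincide.\<close>

lemma min_inner_less_zhat:
  fixes z :: "'n::{finite,wellorder} rvec"
  assumes q: "CARD('n) \<ge> 2" and z: "z \<in> mean_zero" "norm z = 1" "z \<noteq> zhat"
  shows "min_inner z < min_inner (zhat :: 'n rvec)"
proof -
  have nz: "norm (zhat :: 'n rvec) = 1" using zhat_unit_ascending[OF q] by (simp add: unit_ascending_def)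
  have "z \<bullet> zhat \<noteq> 1" using norm_cauchy_schwarz_eq[of z zhat] z nz by auto
  moreover have "z \<bullet> zhat \<le> 1" using norm_cauchy_schwarz[of z zhat] z nz by simp
  ultimately have "z \<bullet> zhat < 1" by simp
  then have "min_inner (zhat :: 'n rvec) * (z \<bullet> zhat) < min_inner (zhat :: 'n rvec)"
    using min_inner_zhat_pos[OF q] by simp
  then show ?thesis using min_inner_le_inner_zhat[OF q z(1)] by linarith
qed

lemma Lambda_hat_eq:
  assumes q: "CARD('n) \<ge> 2"
  shows "Lambda_hat TYPE('n::{finite,wellorder}) = min_inner (zhat :: 'n rvec)"
  unfolding Lambda_hat_def
proof (rule cSup_eq_maximum)
  fix m assume "m \<in> min_inner ` (unit_ascending :: 'n rvec set)"
  then obtain z :: "'n rvec" where "m = min_inner z" "z \<in> unit_ascending" by blast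
  then show "m \<le> min_inner (zhat :: 'n rvec)"
    using min_inner_less_zhat[OF q, of z] by (cases "z = zhat") (auto simp: unit_ascending_def)
qed (use zhat_unit_ascending[OF q] in blast)

text \<open>As \<open>u\<close> sums to 0, a constant may be subtracted from \<open>y\<close>. With
  the entry of \<open>y\<close> at position k as this constant, \<open>y - c\<close> and
  \<open>u\<close> change sign at the same place, so every summand is nonnegative.\<close>

lemma ascending_inner_nonneg:
  fixes y u :: "'n::{finite,wellorder} rvec"
  assumes y: "y \<in> ascending" and u: "u \<in> mean_zero" and k: "k \<in> {1..CARD('n)}"
    and neg: "\<And>i. index i \<le> k \<Longrightarrow> u $ i \<le> 0" and pos: "\<And>i. k < index i \<Longrightarrow> 0 \<le> u $ i"
  shows "0 \<le> y \<bullet> u"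
proof -
  define c where "c = y $ unindex k"
  have "y \<bullet> u = (\<Sum>i\<in>UNIV. (y $ i - c) * u $ i) + c * (\<Sum>i\<in>UNIV. u $ i)"
    by (simp add: inner_vec_def left_diff_distrib sum_subtractf sum_distrib_left)
  also have "\<dots> = (\<Sum>i\<in>UNIV. (y $ i - c) * u $ i)" using u by (simp add: mean_zero_sum)
  also have "\<dots> \<ge> 0"
  proof (rule sum_nonneg)
    fix i :: 'n
    show "0 \<le> (y $ i - c) * u $ i"
    proof (cases "index i \<le> k")
      case True
      then have "index i \<le> index (unindex k :: 'n)" using k by simp
      then have "y $ i \<le> c" using y unfolding index_le_iff c_def ascending_def by blast
      then show ?thesis using neg[OF True] by (simp add: mult_nonpos_nonpos)
    next
      case False
      then have "index (unindex k :: 'n) \<le> index i" using k by simp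
      then have "c \<le> y $ i" using y unfolding index_le_iff c_def ascending_def by blast
      then show ?thesis using pos False by simp
    qed
  qed
  finally show ?thesis .
qed

lemma zvec_bounds:
  assumes k: "k \<in> {1..<CARD('n)}"
  shows "index i \<le> k \<Longrightarrow> zvec k $ (i :: 'n::{finite,wellorder}) < 0"
    and "k < index i \<Longrightarrow> 0 < zvec k $ (i :: 'n)"
    and "index i \<le> k \<Longrightarrow> zvec k $ (i :: 'n) \<le> zvec k $ (j :: 'n)"
    and "k < index i \<Longrightarrow> zvec k $ (j :: 'n) \<le> zvec k $ (i :: 'n)"
proof -
  show n: "index i \<le> k \<Longrightarrow> zvec k $ i < 0" for i :: 'n using k by (auto simp: zvec_def)
  show p: "k < index i \<Longrightarrow> 0 < zvec k $ i" for i :: 'n using k by (auto simp: zvec_def)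
  show "index i \<le> k \<Longrightarrow> zvec k $ i \<le> zvec k $ j"
    using n[of i] p[of j] by (cases "index j \<le> k") (auto simp: zvec_def)
  show "k < index i \<Longrightarrow> zvec k $ j \<le> zvec k $ i"
    using n[of j] p[of i] by (cases "index j \<le> k") (auto simp: zvec_def)
qed

lemma min_inner_nonneg:
  assumes "CARD('n) \<ge> 2" and y: "(y :: 'n::{finite,wellorder} rvec) \<in> ascending"
  shows "0 \<le> min_inner y"
proof -
  obtain k where k: "k \<in> {1..<CARD('n)}" "min_inner y = y \<bullet> zvec k"
    using min_inner_attained[OF assms(1)] .
  have "0 \<le> y \<bullet> zvec k"
    by (rule ascending_inner_nonneg[OF y, of _ k])
      (use k zvec_unit_ascending[OF k(1)] zvec_bounds(1,2)[OF k(1)] in \<open>auto simp: unit_ascending_def less_imp_le\<close>)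
  then show ?thesis using k(2) by simp
qed

text \<open>Otherwise \<open>z\<close> would have inner product at least 1 with the unit vectors
  \<open>zvec 1\<close> and \<open>zvec 2\<close>, hence equal both; but these differ in sign at
  position 2. The bound makes \<open>min_inner z\<close> an admissible threshold for caps.\<close>

lemma min_inner_less_1:
  fixes z :: "'n::{finite,wellorder} rvec"
  assumes q: "CARD('n) \<ge> 3" and z: "norm z = 1"
  shows "min_inner z < 1"
proof (rule ccontr)
  assume "\<not> min_inner z < 1"
  then have "1 \<le> z \<bullet> zvec k" if "k \<in> {1..<CARD('n)}" for k using min_inner_le[OF that, of z] by simp
  moreover have "norm (zvec k :: 'n rvec) = 1" if "k \<in> {1..<CARD('n)}" for k
    using zvec_unit_ascending[OF that] by (simp add: unit_ascending_def)
  ultimately have "z = zvec k" if "k \<in> {1..<CARD('n)}" for k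
    using norm_cauchy_schwarz[of z "zvec k"] norm_cauchy_schwarz_eq[of z "zvec k"] z that by force
  from this[of 1] this[of 2] have "(zvec 1 :: 'n rvec) = zvec 2" using q by simp
  moreover have "(zvec 1 :: 'n rvec) $ unindex 2 > 0" "(zvec 2 :: 'n rvec) $ unindex 2 < 0"
    using q zvec_bounds(2)[where 'n='n, of 1 "unindex 2"] zvec_bounds(1)[where 'n='n, of 2 "unindex 2"] by auto
  ultimately show False by simp
qed

section \<open>Permutation orbits, their empty caps and the angular discrepancy\<close>

lemma perm_orbit_eq: "perm_orbit y = {\<chi> i. y $ p i | p. p permutes UNIV}"
proof -
  have *: "(\<chi> i j. if j = p i then 1 else 0) *v y = (\<chi> i. y $ p i)" for p :: "'a \<Rightarrow> 'a"
    by (simp add: matrix_vector_mult_def vec_eq_iff if_distrib[of "\<lambda>x. x * _"] cong: if_cong)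
  then show ?thesis unfolding perm_orbit_def permutation_matrix_def by (simp add: set_eq_iff) (metis *)
qed

lemma inner_permute_left:
  assumes p: "p permutes (UNIV :: 'n::finite set)"
  shows "(\<chi> i. y $ p i) \<bullet> (w :: 'n rvec) = y \<bullet> (\<chi> i. w $ inv p i)"
  using sum.permute[OF p, of "\<lambda>i. y $ i * w $ inv p i"]
  by (simp add: inner_vec_def o_def permutes_inverses[OF p])

lemma permute_msphere:
  assumes p: "p permutes UNIV" and y: "y \<in> msphere \<rho>"
  shows "(\<chi> i. y $ p i) \<in> msphere \<rho>"
proof -
  have "norm (\<chi> i. y $ p i) = norm y"
    using sum.permute[OF p, of "\<lambda>i. (y $ i)\<^sup>2"] by (simp add: norm_vec_def L2_set_def o_def)
  moreover have "(\<Sum>i\<in>UNIV. y $ p i) = (\<Sum>i\<in>UNIV. y $ i)"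
    using sum.permute[OF p, of "\<lambda>i. y $ i"] by (simp add: o_def)
  ultimately show ?thesis using y by (simp add: msphere_def mean_zero_sum)
qed

lemma sorting_permutation:
  fixes w :: "'n::{finite,wellorder} rvec"
  obtains p where "p permutes (UNIV :: 'n set)" "(\<chi> i. w $ p i) \<in> ascending"
proof -
  define xs where "xs = sort_key (\<lambda>i. w $ i) (sorted_list_of_set (UNIV :: 'n set))"
  have xs: "distinct xs" "set xs = UNIV" "length xs = CARD('n)" "sorted (map (\<lambda>i. w $ i) xs)"
    by (simp_all add: xs_def)
  \<comment> \<open>Positions given by \<open>index\<close> start at 1, those in a list at
    0.\<close>
  define p where "p i = xs ! (index i - 1)" for i :: 'n
  have ix: "index i - 1 < length xs" for i :: 'n
    using index_bounds[of i] xs(3) by linarith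
  have "inj p"
  proof (rule injI)
    fix i j assume "p i = p j"
    then have "index i - 1 = index j - 1"
      using xs(1) ix by (simp add: p_def nth_eq_iff_index_eq)
    then have "index i = index j" using index_bounds[of i] index_bounds[of j] by linarith
    then show "i = j" by (metis unindex_index)
  qed
  then have "p permutes UNIV"
    by (intro bij_imp_permutes) (auto simp: bij_betw_def finite_UNIV_inj_surj)
  moreover have "w $ p i \<le> w $ p j" if "i \<le> j" for i j
    using sorted_nth_mono[OF xs(4), of "index i - 1" "index j - 1"] that ix[of i] ix[of j]
    by (simp add: p_def index_le_iff[symmetric] diff_le_mono)
  ultimately show ?thesis using that by (simp add: ascending_def)
qed

text \<open>A rearrangement inequality. On the first k positions \<open>zvec k\<close> takes its
  smallest value, on the others its largest. Thus \<open>zvec k\<close> minus any permutation of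
  itself is nonpositive and then nonnegative, as \<open>ascending_inner_nonneg\<close>
  requires.\<close>

lemma permute_inner_zvec_le:
  fixes y :: "'n::{finite,wellorder} rvec"
  assumes y: "y \<in> ascending" and p: "p permutes UNIV" and k: "k \<in> {1..<CARD('n)}"
  shows "(\<chi> i. y $ p i) \<bullet> zvec k \<le> y \<bullet> zvec k"
proof -
  define u :: "'n rvec" where "u = zvec k - (\<chi> i. zvec k $ inv p i)"
  have "(zvec k :: 'n rvec) \<in> msphere 1"
    using zvec_unit_ascending[OF k] by (simp add: unit_ascending_def msphere_def)
  moreover from this have "(\<chi> i. (zvec k :: 'n rvec) $ inv p i) \<in> msphere 1"
    by (rule permute_msphere[OF permutes_inv[OF p]])
  ultimately have "u \<in> mean_zero"
    by (simp add: u_def msphere_def mean_zero_def inner_diff_left)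
  then have "0 \<le> y \<bullet> u"
    by (rule ascending_inner_nonneg[OF y, of _ k])
      (use k zvec_bounds(3,4)[OF k] in \<open>auto simp: u_def\<close>)
  then show ?thesis by (simp add: inner_permute_left[OF p] u_def inner_diff_right)
qed

lemma empty_cap_imp_ge:
  fixes z :: "'n::{finite,wellorder} rvec"
  assumes q: "CARD('n) \<ge> 2" and \<rho>: "\<rho> > 0" and z: "z \<in> unit_ascending"
    and w: "w \<in> msphere \<rho>" and empty: "perm_orbit (\<rho> *\<^sub>R z) \<inter> cap \<rho> w t = {}"
  shows "min_inner z \<le> t"
proof -
  have z': "z \<in> mean_zero" "z \<in> ascending" "norm z = 1" using z by (auto simp: unit_ascending_def)
  obtain p where p: "p permutes (UNIV :: 'n set)" "(\<chi> i. w $ p i) \<in> ascending"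
    by (rule sorting_permutation)
  define w' where "w' = (\<chi> i. w $ p i) /\<^sub>R \<rho>"
  have pw: "(\<chi> i. w $ p i) \<in> msphere \<rho>" using p(1) w by (rule permute_msphere)
  then have "w' \<in> unit_ascending"
    using p(2) \<rho> by (auto simp: w'_def unit_ascending_def msphere_def mean_zero_def ascending_def divide_right_mono)
  then have "min_inner z \<le> z \<bullet> w'"
    using z' min_inner_nonneg[OF q z'(2)] by (intro min_inner_le_inner)
  also have "z \<bullet> w' = (\<rho> *\<^sub>R z) \<bullet> (\<chi> i. w $ p i) / \<rho>\<^sup>2"
    using \<rho> by (simp add: w'_def power2_eq_square field_simps)
  \<comment> \<open>The permutation that sorts \<open>w\<close> is moved to the other factor as its
    inverse. There it produces a point of the orbit, which the empty cap must miss.\<close>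
  also have "(\<rho> *\<^sub>R z) \<bullet> (\<chi> i. w $ p i) = (\<chi> i. (\<rho> *\<^sub>R z) $ inv p i) \<bullet> w"
    using inner_permute_left[OF permutes_inv[OF p(1)], of "\<rho> *\<^sub>R z" w] by (simp add: permutes_inv_inv[OF p(1)])
  also have "\<dots> \<le> \<rho>\<^sup>2 * t"
  proof -
    have "(\<chi> i. (\<rho> *\<^sub>R z) $ inv p i) \<in> perm_orbit (\<rho> *\<^sub>R z)"
      unfolding perm_orbit_eq using permutes_inv[OF p(1)] by blast
    moreover have "\<rho> *\<^sub>R z \<in> msphere \<rho>" using z' \<rho> by (simp add: msphere_def mean_zero_def)
    then have "(\<chi> i. (\<rho> *\<^sub>R z) $ inv p i) \<in> msphere \<rho>"
      by (rule permute_msphere[OF permutes_inv[OF p(1)]])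
    ultimately show ?thesis using empty by (force simp: cap_def)
  qed
  finally show ?thesis using \<rho> by (simp add: divide_right_mono)
qed

text \<open>The centre is the \<open>zvec k\<close> with the smallest inner product, scaled to the
  sphere. By rearrangement no permutation of \<open>z\<close> comes closer to it than
  \<open>z\<close> itself, and the scaled \<open>z\<close> lies on the boundary of the cap, which is
  open.\<close>

lemma empty_cap_min_inner:
  fixes z :: "'n::{finite,wellorder} rvec"
  assumes q: "CARD('n) \<ge> 2" and \<rho>: "\<rho> > 0" and z: "z \<in> ascending"
  obtains w where "w \<in> msphere \<rho>" "perm_orbit (\<rho> *\<^sub>R z) \<inter> cap \<rho> w (min_inner z) = {}"
proof -
  obtain k where k: "k \<in> {1..<CARD('n)}" "min_inner z = z \<bullet> zvec k"
    using min_inner_attained[OF q] .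
  have asc: "\<rho> *\<^sub>R z \<in> ascending" using z \<rho> by (simp add: ascending_def)
  have "x \<bullet> (\<rho> *\<^sub>R zvec k) \<le> \<rho>\<^sup>2 * min_inner z" if x: "x \<in> perm_orbit (\<rho> *\<^sub>R z)" for x
  proof -
    have "x \<bullet> zvec k \<le> (\<rho> *\<^sub>R z) \<bullet> zvec k"
      using x permute_inner_zvec_le[OF asc _ k(1)] unfolding perm_orbit_eq by blast
    then have "\<rho> * (x \<bullet> zvec k) \<le> \<rho> * ((\<rho> *\<^sub>R z) \<bullet> zvec k)" using \<rho> by simp
    then show ?thesis by (simp add: k(2) power2_eq_square mult.assoc)
  qed
  then have "perm_orbit (\<rho> *\<^sub>R z) \<inter> cap \<rho> (\<rho> *\<^sub>R zvec k) (min_inner z) = {}"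
    by (force simp: cap_def)
  moreover have "\<rho> *\<^sub>R zvec k \<in> (msphere \<rho> :: 'n rvec set)"
    using zvec_unit_ascending[OF k(1)] \<rho> by (simp add: unit_ascending_def msphere_def mean_zero_def)
  ultimately show ?thesis using that by blast
qed

lemma LECAD_perm_orbit:
  fixes z :: "'n::{finite,wellorder} rvec"
  assumes q: "CARD('n) \<ge> 3" and \<rho>: "\<rho> > 0" and z: "z \<in> unit_ascending"
  shows "LECAD \<rho> (perm_orbit (\<rho> *\<^sub>R z)) = arccos (min_inner z)"
  unfolding LECAD_def
proof (rule cSup_eq_maximum)
  have q2: "CARD('n) \<ge> 2" using q by simp
  have z': "z \<in> ascending" "norm z = 1" using z by (auto simp: unit_ascending_def)
  have m: "0 \<le> min_inner z" "min_inner z < 1"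
    using min_inner_nonneg[OF q2 z'(1)] min_inner_less_1[OF q z'(2)] by auto
  show "arccos (min_inner z) \<in> {arccos t |w t. w \<in> msphere \<rho> \<and> - 1 \<le> t \<and> t < 1 \<and>
      perm_orbit (\<rho> *\<^sub>R z) \<inter> cap \<rho> w t = {}}"
    using empty_cap_min_inner[OF q2 \<rho> z'(1)] m by (smt (verit) mem_Collect_eq)
  fix x assume "x \<in> {arccos t |w t. w \<in> msphere \<rho> \<and> - 1 \<le> t \<and> t < 1 \<and>
      perm_orbit (\<rho> *\<^sub>R z) \<inter> cap \<rho> w t = {}}"
  then show "x \<le> arccos (min_inner z)"
    using empty_cap_imp_ge[OF q2 \<rho> z] m by (auto intro!: arccos_le_arccos)
qed

section \<open>The equally spaced vector \<open>ybar\<close>\<close>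

lemma norm_ybar:
  "norm (ybar :: 'n::{finite,wellorder} rvec) = sqrt (real CARD('n) * ((real CARD('n))\<^sup>2 - 1) / 12)"
proof -
  \<comment> \<open>The centre \<open>c\<close> is kept general because the actual one depends on
    the number of summands, which the induction varies.\<close>
  have "(\<Sum>k=1..n. (real k - c)\<^sup>2) = real n * (real n + 1) * (2 * real n + 1) / 6 - c * real n * (real n + 1) + real n * c\<^sup>2"
    for n c
    by (induction n) (simp_all add: power2_eq_square field_simps)
  from this[of "(real CARD('n) + 1) / 2" "CARD('n)"]
  have "(\<Sum>k=1..CARD('n). (real k - (real CARD('n) + 1) / 2)\<^sup>2) = real CARD('n) * ((real CARD('n))\<^sup>2 - 1) / 12"
    by (simp add: power2_eq_square field_simps)
  moreover have "(\<Sum>i\<in>UNIV. ((ybar :: 'n rvec) $ i)\<^sup>2) = (\<Sum>k=1..CARD('n). (real k - (real CARD('n) + 1) / 2)\<^sup>2)"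
    unfolding sum_unindex by (intro sum.cong) (simp_all add: ybar_def)
  ultimately show ?thesis by (simp add: norm_vec_def L2_set_def)
qed

lemma sum_ybar:
  assumes "k \<le> CARD('n)"
  shows "(\<Sum>i | index i \<le> k. (ybar :: 'n::{finite,wellorder} rvec) $ i) = - (real k * (real CARD('n) - real k) / 2)"
proof -
  have "(\<Sum>j=1..n. real j - c) = real n * (real n + 1) / 2 - real n * c" for n c
    by (induction n) (simp_all add: field_simps)
  note arith = this
  have "(\<Sum>i | index i \<le> k. (ybar :: 'n rvec) $ i) = (\<Sum>j=1..k. real j - (real CARD('n) + 1) / 2)"
    unfolding sum_index_le_unindex[OF assms] using assms by (intro sum.cong) (simp_all add: ybar_def)
  also have "\<dots> = real k * (real k + 1) / 2 - real k * ((real CARD('n) + 1) / 2)" by (rule arith)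
  also have "\<dots> = - (real k * (real CARD('n) - real k) / 2)" by (simp add: field_simps)
  finally show ?thesis .
qed

text \<open>The inner products of \<open>yhat\<close> with the \<open>zvec k\<close> are all equal,
  whereas those of \<open>ybar\<close> are q / 2 times sqrt (k (q - k) / q). For k = 1 and k = 2
  these agree only if q = 3, where k and q - k are exchanged.\<close>

lemma yhat_neq_ybar:
  assumes q: "CARD('n) \<ge> 4"
  shows "(yhat :: 'n::{finite,wellorder} rvec) \<noteq> ybar"
proof
  assume eq: "(yhat :: 'n rvec) = ybar"
  define Q where "Q = real CARD('n)"
  define s where "s k = sqrt (real k * (Q - real k) / Q)" for k
  have "{i :: 'n. index i \<le> CARD('n)} = UNIV" using index_bounds by auto
  then have mz: "(ybar :: 'n rvec) \<in> mean_zero"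
    using sum_ybar[where 'n='n, of "CARD('n)"] by (simp add: mean_zero_sum)
  have Q: "Q \<ge> 4" using q by (simp add: Q_def)
  have s2: "real k * (Q - real k) = Q * (s k)\<^sup>2" and s0: "s k > 0" if "k \<in> {1,2}" for k
    using that Q by (auto simp: s_def)
  have S: "(ybar :: 'n rvec) \<bullet> zvec k = Q / 2 * s k" if k: "k \<in> {1,2}" for k
  proof -
    have "s k * ((ybar :: 'n rvec) \<bullet> zvec k) = real k * (Q - real k) / 2"
      using inner_zvec[OF mz, of k] sum_ybar[where 'n='n, of k] k q by (auto simp: s_def Q_def)
    also have "\<dots> = s k * (Q / 2 * s k)" using s2[OF k] by (simp add: power2_eq_square)
    finally show ?thesis using s0[OF k] by simp
  qed
  have "(ybar :: 'n rvec) \<bullet> zvec 1 = (ybar :: 'n rvec) \<bullet> zvec 2"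
    unfolding eq[symmetric] using q by (simp add: yhat_def zhat_def ahat_inner_zvec)
  then have "s 1 = s 2" using S[of 1] S[of 2] Q by simp
  then have "Q - 1 = 2 * (Q - 2)" using s2[of 1] s2[of 2] by simp
  then show False using Q by simp
qed

section \<open>The uniform measure of a cap\<close>

lemma continuous_imp_integrable_msphere:
  fixes U :: "'n::{finite,wellorder} rvec measure" and h :: "'n rvec \<Rightarrow> real"
  assumes U: "uniform_on_msphere \<rho> U" and h: "continuous_on UNIV h"
  shows "integrable U h"
proof -
  interpret prob_space U using U by (simp add: uniform_on_msphere_def)
  have "h \<in> borel_measurable (restrict_space borel (msphere \<rho>))"
    using h by (intro measurable_restrict_space1 borel_measurable_continuous_onI)
  then have m: "h \<in> borel_measurable U"
    using U by (simp add: uniform_on_msphere_def cong: measurable_cong_sets)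
  have "compact (h ` cball 0 \<rho>)"
    using h by (intro compact_continuous_image) (auto intro: continuous_on_subset)
  then obtain B where B: "\<And>x. x \<in> cball 0 \<rho> \<Longrightarrow> norm (h x) \<le> B"
    by (metis bounded_iff compact_imp_bounded image_eqI)
  have "AE x in U. norm (h x) \<le> B"
    using U by (intro AE_I2 B) (auto simp: uniform_on_msphere_def msphere_def)
  then show ?thesis using m by (rule integrable_const_bound)
qed

text \<open>For \<open>u\<close> different from \<open>w\<close>, the Householder reflection along
  \<open>d = u - w\<close>. Equal norms give \<open>d \<bullet> d = 2 * (d \<bullet> u)\<close>, so
  it exchanges \<open>u\<close> and \<open>w\<close>. It preserves the mean-zero space because
  \<open>d\<close> lies in it, and maps onto it because it is an involution.\<close>

lemma reflection_mean_zero: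
  fixes u w :: "'n::{finite,wellorder} rvec"
  assumes u: "u \<in> mean_zero" and w: "w \<in> mean_zero" and n: "norm u = norm w"
  obtains f where "orthogonal_transformation f" "f ` mean_zero = mean_zero"
    "\<And>v. f v \<bullet> u = v \<bullet> w"
proof (cases "u = w")
  case True
  then show ?thesis using that[of id] by (simp add: id_def)
next
  case False
  define d where "d = u - w"
  define f where "f v = v - (2 * (v \<bullet> d) / (d \<bullet> d)) *\<^sub>R d" for v
  have "d \<noteq> 0" using False by (simp add: d_def)
  then have d: "d \<in> mean_zero" "d \<bullet> d > 0"
    using u w by (simp add: mean_zero_def d_def inner_diff_left) (simp add: \<open>d \<noteq> 0\<close>)
  have lin: "linear f"
    unfolding f_def
    by (rule linearI) (simp_all add: algebra_simps inner_add_left add_divide_distrib)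
  have inn: "f v \<bullet> f v' = v \<bullet> v'" for v v'
  proof -
    define a b where "a = 2 * (v \<bullet> d) / (d \<bullet> d)" and "b = 2 * (v' \<bullet> d) / (d \<bullet> d)"
    have vd: "v \<bullet> d = a * (d \<bullet> d) / 2" "v' \<bullet> d = b * (d \<bullet> d) / 2"
      using d(2) by (simp_all add: a_def b_def)
    have fv: "f v \<bullet> f v' = v \<bullet> v' - b * (v \<bullet> d) - a * (v' \<bullet> d) + a * b * (d \<bullet> d)"
      unfolding f_def a_def[symmetric] b_def[symmetric]
      by (simp add: inner_diff_left inner_diff_right inner_commute right_diff_distrib)
    show ?thesis unfolding fv vd by simp
  qed
  have ff: "f (f v) = v" for v
    using d(2) by (simp add: f_def inner_diff_left algebra_simps)
  have fm: "f v \<in> mean_zero" if "v \<in> mean_zero" for v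
    using that d(1) by (simp add: f_def mean_zero_def inner_diff_left)
  have "u \<bullet> u = w \<bullet> w" using n by (simp add: dot_square_norm)
  then have dd: "d \<bullet> d = 2 * (d \<bullet> u)"
    by (simp add: d_def inner_diff_left inner_diff_right inner_commute)
  have "f v \<bullet> u = v \<bullet> w" for v
  proof -
    have "f v \<bullet> u = v \<bullet> u - 2 * (v \<bullet> d) / (d \<bullet> d) * (d \<bullet> u)"
      by (simp add: f_def inner_diff_left)
    also have "\<dots> = v \<bullet> u - v \<bullet> d" using d(2) unfolding dd by simp
    finally show ?thesis by (simp add: d_def inner_diff_right)
  qed
  moreover have "f ` mean_zero = mean_zero"
    by (metis ff fm image_subsetI subset_antisym subsetI image_eqI)
  moreover have "orthogonal_transformation f"
    using lin inn by (simp add: orthogonal_transformation_def)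
  ultimately show ?thesis using that by blast
qed

lemma borel_measurable_inner_msphere:
  assumes "uniform_on_msphere \<rho> U"
  shows "(\<lambda>v. v \<bullet> u) \<in> borel_measurable U"
proof -
  have "(\<lambda>v. v \<bullet> u) \<in> borel_measurable (restrict_space borel (msphere \<rho>))"
    by (intro measurable_restrict_space1 borel_measurable_continuous_onI continuous_intros)
  then show ?thesis
    using assms by (simp add: uniform_on_msphere_def cong: measurable_cong_sets)
qed

lemma distr_inner_eq:
  fixes U :: "'n::{finite,wellorder} rvec measure"
  assumes U: "uniform_on_msphere \<rho> U"
    and u: "u \<in> mean_zero" and w: "w \<in> mean_zero" and n: "norm u = norm w"
  shows "distr U borel (\<lambda>v. v \<bullet> u) = distr U borel (\<lambda>v. v \<bullet> w)"
proof -
  obtain f where f: "orthogonal_transformation f" "f ` mean_zero = mean_zero"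
      "\<And>v. f v \<bullet> u = v \<bullet> w"
    using reflection_mean_zero[OF u w n] by blast
  have "f \<in> borel \<rightarrow>\<^sub>M borel"
    using f(1) by (intro borel_measurable_continuous_onI linear_continuous_on)
      (simp add: linear_conv_bounded_linear[symmetric] orthogonal_transformation_linear)
  moreover have "f x \<in> msphere \<rho>" if "x \<in> msphere \<rho>" for x
    using that f by (auto simp: msphere_def orthogonal_transformation_norm)
  ultimately have "f \<in> restrict_space borel (msphere \<rho>) \<rightarrow>\<^sub>M restrict_space borel (msphere \<rho>)"
    by (auto intro!: measurable_restrict_space3)
  then have fU: "f \<in> U \<rightarrow>\<^sub>M U"
    using U by (simp add: uniform_on_msphere_def cong: measurable_cong_sets)
  have "distr U borel (\<lambda>v. v \<bullet> u) = distr (distr U U f) borel (\<lambda>v. v \<bullet> u)"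
    using U f by (simp add: uniform_on_msphere_def)
  also have "\<dots> = distr U borel (\<lambda>v. v \<bullet> w)"
    using fU borel_measurable_inner_msphere[OF U] by (subst distr_distr) (simp_all add: o_def f(3))
  finally show ?thesis .
qed

lemma expectation_inner_eq:
  fixes U :: "'n::{finite,wellorder} rvec measure" and g :: "real \<Rightarrow> real"
  assumes U: "uniform_on_msphere \<rho> U"
    and u: "u \<in> mean_zero" and w: "w \<in> mean_zero" and n: "norm u = norm w"
    and g: "g \<in> borel_measurable borel"
  shows "(\<integral>v. g (v \<bullet> u) \<partial>U) = (\<integral>v. g (v \<bullet> w) \<partial>U)"
  using arg_cong[OF distr_inner_eq[OF U u w n], of "\<lambda>M. \<integral>x. g x \<partial>M"] g
  by (simp add: integral_distr borel_measurable_inner_msphere[OF U])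

lemma coeff_one_plus_square_power:
  "coeff ([:1, 0, 1::'a::comm_ring_1:] ^ m) 0 = 1"
  "coeff ([:1, 0, 1::'a:] ^ m) (Suc 0) = 0"
  "coeff ([:1, 0, 1::'a:] ^ m) 2 = of_nat m"
  by (induction m) (simp_all add: numeral_2_eq_2 algebra_simps)

text \<open>The second-order terms in \<open>s\<close> of the \<open>2 m\<close>-th moment along
  \<open>e + s b\<close>, which by rotation invariance is \<open>(1 + s\<^sup>2) ^ m\<close> times the one along \<open>e\<close>.\<close>

lemma mixed_moment:
  fixes U :: "'n::{finite,wellorder} rvec measure"
  assumes U: "uniform_on_msphere \<rho> U"
    and e: "e \<in> mean_zero" "norm e = 1" and b: "b \<in> mean_zero" "norm b = 1" and eb: "e \<bullet> b = 0"
  shows "real (2 * j + 1) * (\<integral>v. (v \<bullet> b)\<^sup>2 * (v \<bullet> e) ^ (2 * j) \<partial>U) =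
    (\<integral>v. (v \<bullet> e) ^ (2 * Suc j) \<partial>U)"
proof -
  define m where "m = Suc j"
  define E where "E k = (\<integral>v. (v \<bullet> b) ^ k * (v \<bullet> e) ^ (2 * m - k) \<partial>U)" for k
  \<comment> \<open>The moment is a polynomial in \<open>s\<close>, so two expressions for it that
    agree for all \<open>s\<close> can be compared coefficient by coefficient; no differentiation
    under the integral is involved.\<close>
  define p where "p = (\<Sum>k\<le>2 * m. monom (real (2 * m choose k) * E k) k)"
  define r where "r = smult (E 0) ([:1, 0, 1:] ^ m)"
  have int: "integrable U (\<lambda>v. (v \<bullet> b) ^ k * (v \<bullet> e) ^ l)" for k l
    by (intro continuous_imp_integrable_msphere[OF U] continuous_intros)
  have "poly p s = poly r s" for s
  proof -
    \<comment> \<open>The length of \<open>e + s *\<^sub>R b\<close>, by Pythagoras.\<close>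
    define c where "c = sqrt (1 + s\<^sup>2)"
    have ne: "(norm (e + s *\<^sub>R b))\<^sup>2 = 1 + s\<^sup>2"
      using e b eb unfolding power2_norm_eq_inner
      by (simp add: norm_eq_1 inner_add_left inner_add_right inner_commute power2_eq_square)
    have "norm (e + s *\<^sub>R b) = norm (c *\<^sub>R e)"
      using e real_sqrt_unique[OF ne] by (simp add: c_def)
    moreover have "e + s *\<^sub>R b \<in> mean_zero" "c *\<^sub>R e \<in> mean_zero"
      using e b by (simp_all add: mean_zero_def inner_add_left)
    ultimately have "(\<integral>v. (v \<bullet> (e + s *\<^sub>R b)) ^ (2 * m) \<partial>U) = (\<integral>v. (v \<bullet> (c *\<^sub>R e)) ^ (2 * m) \<partial>U)"
      by (intro expectation_inner_eq[OF U]) auto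
    also have "\<dots> = (1 + s\<^sup>2) ^ m * E 0"
      by (simp add: E_def c_def power_mult_distrib) (simp add: power_mult)
    also have "\<dots> = poly r s" by (simp add: r_def power2_eq_square)
    also have "(\<integral>v. (v \<bullet> (e + s *\<^sub>R b)) ^ (2 * m) \<partial>U) =
        (\<integral>v. (\<Sum>k\<le>2 * m. real (2 * m choose k) * s ^ k * ((v \<bullet> b) ^ k * (v \<bullet> e) ^ (2 * m - k))) \<partial>U)"
      by (simp add: inner_add_right add.commute[of "_ \<bullet> e"] binomial_ring power_mult_distrib mult_ac)
    also have "\<dots> = (\<Sum>k\<le>2 * m. real (2 * m choose k) * s ^ k * E k)"
      unfolding E_def using int by (subst Bochner_Integration.integral_sum) auto
    also have "\<dots> = poly p s" by (simp add: p_def poly_sum poly_monom mult_ac)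
    finally show ?thesis .
  qed
  then have "p = r" using poly_eq_poly_eq_iff by blast
  then have "coeff p 2 = coeff r 2" by simp
  moreover have "coeff p 2 = real (2 * m choose 2) * E 2"
    by (simp add: p_def coeff_sum m_def del: binomial_Suc_Suc) (simp add: numeral_2_eq_2)
  moreover have "real (2 * m choose 2) = real m * real (2 * j + 1)"
    by (simp add: m_def choose_two algebra_simps)
  ultimately have "real m * (real (2 * j + 1) * E 2) = real m * E 0"
    by (simp add: r_def coeff_one_plus_square_power mult_ac)
  then show ?thesis by (simp add: m_def E_def)
qed

text \<open>On [0,1] all absolute moments are at most 1, so the Taylor polynomial of degree n
  approximates the characteristic function at t up to 2 |t|^n / n!. Its coefficients involve only
  moments, so the two characteristic functions agree in the limit.\<close>

lemma real_distribution_eqI_moments: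
  assumes M: "real_distribution M" "AE x in M. x \<in> {0..1}"
    and N: "real_distribution N" "AE x in N. x \<in> {0..1}"
    and mom: "\<And>k. (\<integral>x. x ^ k \<partial>M) = (\<integral>x. x ^ k \<partial>N)"
  shows "M = N"
proof (rule Levy_uniqueness[OF M(1) N(1)], rule ext)
  fix t :: real
  have approx: "cmod (char L t - (\<Sum>k\<le>n. ((\<i> * t) ^ k / fact k) * (\<integral>x. x ^ k \<partial>L))) \<le> 2 * (\<bar>t\<bar> ^ n / fact n)"
    if L: "real_distribution L" "AE x in L. x \<in> {0..1}" for L :: "real measure" and n
  proof -
    interpret real_distribution L by (rule L)
    have bound: "AE x in L. norm (x ^ k) \<le> 1" for k
      using L(2) by eventually_elim (simp add: power_le_one)
    have int: "integrable L (\<lambda>x. x ^ k)" for k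
      by (rule integrable_const_bound[OF bound]) simp
    have "(\<integral>x. \<bar>x\<bar> ^ n \<partial>L) \<le> (\<integral>x. 1 \<partial>L)"
      using int[of n] bound[of n] integrable_abs[OF int[of n]]
      by (intro integral_mono_AE) (auto simp: power_abs)
    also have "\<dots> = 1" using prob_space by simp
    finally have "2 * \<bar>t\<bar> ^ n / fact n * (\<integral>x. \<bar>x\<bar> ^ n \<partial>L) \<le> 2 * \<bar>t\<bar> ^ n / fact n * 1"
      by (intro mult_left_mono) auto
    then show ?thesis using char_approx1[of n t] int by simp
  qed
  have le: "cmod (char M t - char N t) \<le> 4 * (\<bar>t\<bar> ^ n / fact n)" for n
  proof -
    define S where "S = (\<Sum>k\<le>n. ((\<i> * t) ^ k / fact k) * (\<integral>x. x ^ k \<partial>N))"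
    have "cmod (char M t - S) \<le> 2 * (\<bar>t\<bar> ^ n / fact n)" "cmod (char N t - S) \<le> 2 * (\<bar>t\<bar> ^ n / fact n)"
      using approx[OF M] approx[OF N] by (simp_all add: S_def mom)
    then show ?thesis using norm_triangle_ineq4[of "char M t - S" "char N t - S"] by simp
  qed
  have "(\<lambda>n. inverse (fact n) * \<bar>t\<bar> ^ n) \<longlonglongrightarrow> 0"
    by (intro summable_LIMSEQ_zero summable_exp)
  then have "(\<lambda>n. 4 * (\<bar>t\<bar> ^ n / fact n)) \<longlonglongrightarrow> 4 * 0"
    by (intro tendsto_mult_left) (simp add: field_simps)
  then have "cmod (char M t - char N t) \<le> 0"
    using le by (intro LIMSEQ_le_const) auto
  then show "char M t = char N t" by simp
qed

section \<open>The beta distribution and its moments\<close>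

definition beta_density :: "real \<Rightarrow> real \<Rightarrow> real \<Rightarrow> real"
  where "beta_density a b z = indicator {0..1} z * (z powr (a - 1) * (1 - z) powr (b - 1)) / Beta a b"

definition beta_distribution :: "real \<Rightarrow> real \<Rightarrow> real measure"
  where "beta_distribution a b = density lborel (\<lambda>z. ennreal (beta_density a b z))"

lemma Beta_pos: "0 < a \<Longrightarrow> 0 < b \<Longrightarrow> 0 < Beta a (b :: real)"
  by (simp add: Beta_def Gamma_real_pos)

lemma beta_density_nonneg: "0 < a \<Longrightarrow> 0 < b \<Longrightarrow> 0 \<le> beta_density a b z"
  using Beta_pos[of a b] by (simp add: beta_density_def)

lemma borel_measurable_beta_density [measurable]: "beta_density a b \<in> borel_measurable borel"
  unfolding beta_density_def by measurable

text \<open>A factor \<open>z ^ k\<close> shifts the first parameter by k. The density may be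
  unbounded at either end of [0,1]; since it is nonnegative, the value of the gauge integral passes
  to the Lebesgue integral through the nonnegative integral.\<close>

lemma has_bochner_integral_beta_moment:
  assumes a: "0 < a" and b: "0 < b"
  shows "has_bochner_integral lborel (\<lambda>z. beta_density a b z * z ^ k) (Beta (a + real k) b / Beta a b)"
proof (rule has_bochner_integral_nn_integral)
  have B: "0 < Beta a b" using a b by (rule Beta_pos)
  have "0 < Beta (a + real k) b" using a b by (intro Beta_pos) auto
  then show "0 \<le> Beta (a + real k) b / Beta a b" using B by simp
  show "AE z in lborel. 0 \<le> beta_density a b z * z ^ k"
    using B by (auto simp: beta_density_def indicator_def)
  have "((\<lambda>z. z powr (a + real k - 1) * (1 - z) powr (b - 1) / Beta a b) has_integral
      Beta (a + real k) b / Beta a b) {0..1}"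
    using a b by (intro has_integral_divide has_integral_Beta_real) auto
  then have "(\<integral>\<^sup>+z. indicator {0..1} z * (z powr (a + real k - 1) * (1 - z) powr (b - 1) / Beta a b) \<partial>lborel) =
      ennreal (Beta (a + real k) b / Beta a b)"
    using B by (intro nn_integral_has_integral_lebesgue) auto
  also have "(\<lambda>z. indicator {0..1} z * (z powr (a + real k - 1) * (1 - z) powr (b - 1) / Beta a b)) =
      (\<lambda>z. beta_density a b z * z ^ k)"
  proof
    fix z :: real
    \<comment> \<open>At \<open>z = 0\<close> both sides are 0 by the convention for
      \<open>powr\<close>, also when k is 0.\<close>
    have "z powr (a + real k - 1) = z powr (a - 1) * z ^ k" if "0 \<le> z"
    proof (cases "z = 0")
      case False
      then have "z powr (a - 1 + real k) = z powr (a - 1) * z ^ k"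
        using that by (simp add: powr_add powr_realpow)
      then show ?thesis by (simp add: algebra_simps)
    qed simp
    then show "indicator {0..1} z * (z powr (a + real k - 1) * (1 - z) powr (b - 1) / Beta a b) =
      beta_density a b z * z ^ k"
      by (auto simp: beta_density_def indicator_def)
  qed
  finally show "(\<integral>\<^sup>+z. ennreal (beta_density a b z * z ^ k) \<partial>lborel) =
      ennreal (Beta (a + real k) b / Beta a b)" .
qed measurable

lemma beta_distribution:
  assumes a: "0 < a" and b: "0 < b"
  shows "real_distribution (beta_distribution a b)"
    and "AE z in beta_distribution a b. z \<in> {0..1}"
    and "(\<integral>z. z ^ k \<partial>beta_distribution a b) = Beta (a + real k) b / Beta a b"
proof -
  have B: "Beta a b \<noteq> 0" using Beta_pos[OF a b] by simp
  have "(\<integral>\<^sup>+z. ennreal (beta_density a b z) \<partial>lborel) = ennreal 1"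
    using has_bochner_integral_beta_moment[OF a b, of 0] beta_density_nonneg[OF a b] B
    by (subst nn_integral_eq_integral) (auto simp: has_bochner_integral_iff)
  then have "prob_space (beta_distribution a b)"
    by (intro prob_spaceI) (simp add: beta_distribution_def emeasure_density)
  then show "real_distribution (beta_distribution a b)"
    by (simp add: real_distribution_def real_distribution_axioms_def beta_distribution_def)
  show "AE z in beta_distribution a b. z \<in> {0..1}"
    unfolding beta_distribution_def
    by (subst AE_density) (auto simp: beta_density_def indicator_def)
  show "(\<integral>z. z ^ k \<partial>beta_distribution a b) = Beta (a + real k) b / Beta a b"
    unfolding beta_distribution_def
    using has_bochner_integral_beta_moment[OF a b, of k] beta_density_nonneg[OF a b]
    by (subst integral_density) (auto simp: has_bochner_integral_iff)
qed

text \<open>\<open>mixed_moment\<close> is summed over an orthonormal basis \<open>B\<close> of the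
  complement of \<open>e\<close> in the mean-zero space, which has q - 2 elements. On the sphere the
  squares (v . b)^2 add up to \<rho>^2 - (v . e)^2, so only moments along \<open>e\<close>
  remain.\<close>

lemma inner_moment_recurrence:
  fixes U :: "'n::{finite,wellorder} rvec measure"
  assumes U: "uniform_on_msphere \<rho> U" and e: "e \<in> mean_zero" "norm e = 1"
  shows "real (2 * j + 1) * \<rho>\<^sup>2 * (\<integral>v. (v \<bullet> e) ^ (2 * j) \<partial>U) =
    (real (2 * j) + real CARD('n) - 1) * (\<integral>v. (v \<bullet> e) ^ (2 * Suc j) \<partial>U)"
proof -
  define one :: "'n rvec" where "one = (\<chi> i. 1)"
  \<comment> \<open>Orthogonality to the all-ones vector means mean zero, so \<open>T\<close> is the
    complement of \<open>e\<close> within \<open>mean_zero\<close>.\<close>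
  define T where "T = {y. \<forall>x\<in>{one, e}. orthogonal x y}"
  have T_iff: "y \<in> T \<longleftrightarrow> y \<in> mean_zero \<and> y \<bullet> e = 0" for y
    by (auto simp: T_def one_def mean_zero_def orthogonal_def inner_commute)
  have eone: "e \<bullet> one = 0" using e by (simp add: mean_zero_def one_def)
  have "one \<bullet> one \<noteq> 0" by (simp add: one_def inner_ones_ones)
  then have "one \<noteq> 0" by auto
  have "e \<noteq> 0" using e by auto
  then have "e \<noteq> one" using eone by auto
  have "independent {one, e}"
    using eone \<open>one \<noteq> 0\<close> \<open>e \<noteq> 0\<close>
    by (intro pairwise_orthogonal_independent) (auto simp: pairwise_insert orthogonal_def inner_commute)
  moreover have "card {one, e} = 2" using \<open>e \<noteq> one\<close> by auto
  ultimately have "dim {one, e} = 2" using dim_eq_card_independent by metis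
  then have dim2: "dim (span {one, e}) = 2" by simp
  have T_span: "T = {y \<in> UNIV. \<forall>x\<in>span {one, e}. orthogonal x y}"
  proof (intro equalityI subsetI CollectI conjI ballI UNIV_I)
    fix x y assume y: "y \<in> T" and x: "x \<in> span {one, e}"
    have "orthogonal y x"
      by (rule orthogonal_to_span[OF x]) (use y in \<open>auto simp: T_def orthogonal_commute\<close>)
    then show "orthogonal x y" by (simp add: orthogonal_commute)
  next
    fix y assume "y \<in> {y \<in> UNIV. \<forall>x\<in>span {one, e}. orthogonal x y}"
    then show "y \<in> T" unfolding T_def using span_base[of _ "{one, e}"] by blast
  qed
  have dimT: "dim T + 2 = CARD('n)"
    using dim_subspace_orthogonal_to_vectors[of "span {one, e}" UNIV] dim2
    by (simp add: T_span)
  have "subspace T" unfolding T_def by (rule subspace_orthogonal_to_vectors)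
  then obtain B where B: "B \<subseteq> T" "pairwise orthogonal B" "\<And>x. x \<in> B \<Longrightarrow> norm x = 1"
      "independent B" "card B = dim T" "span B = T"
    by (rule orthonormal_basis_subspace) blast
  have finB: "finite B" using B(4) by (rule independent_imp_finite)
  have sum_sq: "(\<Sum>b\<in>B. (v \<bullet> b)\<^sup>2) = \<rho>\<^sup>2 - (v \<bullet> e)\<^sup>2" if v: "v \<in> msphere \<rho>" for v
  proof -
    \<comment> \<open>Removing the component along \<open>e\<close> lands in \<open>T\<close> and
      leaves the inner products with \<open>B\<close> unchanged; expanding \<open>w\<close> in
      \<open>B\<close> gives the sum of squares.\<close>
    define w where "w = v - (v \<bullet> e) *\<^sub>R e"
    have "w \<in> T" using v e by (simp add: T_iff w_def msphere_def mean_zero_def inner_diff_left norm_eq_1)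
    then have w: "w \<in> span B" using B by simp
    have wb: "w \<bullet> b = v \<bullet> b" if "b \<in> B" for b
    proof -
      have "e \<bullet> b = 0" using that B(1) T_iff by (metis inner_commute subsetD)
      then show ?thesis by (simp add: w_def inner_diff_left)
    qed
    have "w \<bullet> w = w \<bullet> (\<Sum>b\<in>B. (w \<bullet> b) *\<^sub>R b)"
      using orthonormal_basis_expand[OF B(2,3) w finB] by simp
    also have "\<dots> = (\<Sum>b\<in>B. (v \<bullet> b)\<^sup>2)"
      by (simp add: inner_sum_right power2_eq_square wb)
    also have "w \<bullet> w = v \<bullet> v - (v \<bullet> e)\<^sup>2"
      using e by (simp add: w_def inner_diff_left inner_diff_right norm_eq_1 inner_commute power2_eq_square)
    also have "v \<bullet> v = \<rho>\<^sup>2" using v by (simp add: msphere_def dot_square_norm)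
    finally show ?thesis by simp
  qed
  define I where "I k = (\<integral>v. (v \<bullet> e) ^ k \<partial>U)" for k
  have int: "integrable U (\<lambda>v. (v \<bullet> b)\<^sup>2 * (v \<bullet> e) ^ l)" "integrable U (\<lambda>v. (v \<bullet> e) ^ l)" for l b
    by (intro continuous_imp_integrable_msphere[OF U] continuous_intros)+
  have "real (card B) * I (2 * Suc j) =
      (\<Sum>b\<in>B. real (2 * j + 1) * (\<integral>v. (v \<bullet> b)\<^sup>2 * (v \<bullet> e) ^ (2 * j) \<partial>U))"
  proof -
    have "real (2 * j + 1) * (\<integral>v. (v \<bullet> b)\<^sup>2 * (v \<bullet> e) ^ (2 * j) \<partial>U) = I (2 * Suc j)" if "b \<in> B" for b
      unfolding I_def using that B(1,3) T_iff e by (intro mixed_moment[OF U]) (auto simp: inner_commute)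
    then show ?thesis by simp
  qed
  also have "\<dots> = real (2 * j + 1) * (\<integral>v. (\<Sum>b\<in>B. (v \<bullet> b)\<^sup>2 * (v \<bullet> e) ^ (2 * j)) \<partial>U)"
    using int by (subst Bochner_Integration.integral_sum) (auto simp: sum_distrib_left)
  also have "(\<integral>v. (\<Sum>b\<in>B. (v \<bullet> b)\<^sup>2 * (v \<bullet> e) ^ (2 * j)) \<partial>U) =
      (\<integral>v. \<rho>\<^sup>2 * (v \<bullet> e) ^ (2 * j) - (v \<bullet> e) ^ (2 * Suc j) \<partial>U)"
  proof (rule Bochner_Integration.integral_cong)
    fix v assume "v \<in> space U"
    then have v: "v \<in> msphere \<rho>" using U by (simp add: uniform_on_msphere_def)
    show "(\<Sum>b\<in>B. (v \<bullet> b)\<^sup>2 * (v \<bullet> e) ^ (2 * j)) =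
        \<rho>\<^sup>2 * (v \<bullet> e) ^ (2 * j) - (v \<bullet> e) ^ (2 * Suc j)"
      unfolding sum_distrib_right[symmetric] sum_sq[OF v] by (simp add: left_diff_distrib power2_eq_square)
  qed simp
  also have "\<dots> = \<rho>\<^sup>2 * I (2 * j) - I (2 * Suc j)"
    unfolding I_def
    by (rule trans[OF Bochner_Integration.integral_diff[OF integrable_mult_right[OF int(2)] int(2)]]) simp
  finally have "real (card B) * I (2 * Suc j) = real (2 * j + 1) * (\<rho>\<^sup>2 * I (2 * j) - I (2 * Suc j))" .
  moreover have "real (card B) = real CARD('n) - 2" using B(5) dimT by simp
  ultimately have "(real CARD('n) - 2) * I (2 * Suc j) = real (2 * j + 1) * (\<rho>\<^sup>2 * I (2 * j) - I (2 * Suc j))"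
    by simp
  then show ?thesis unfolding I_def[symmetric] by (simp add: algebra_simps)
qed

text \<open>By the recurrence, successive moments have ratio (2 j + 1) / (2 j + q - 1). With a = 1/2
  + j and b = (q - 2) / 2 this is a / (a + b), the ratio of \<open>Beta (a + 1) b\<close> to
  \<open>Beta a b\<close>. So all moments agree with those of the beta distribution, and both laws
  live on [0,1].\<close>

lemma distr_inner_square:
  fixes U :: "'n::{finite,wellorder} rvec measure"
  assumes q: "CARD('n) \<ge> 3" and \<rho>: "\<rho> > 0" and U: "uniform_on_msphere \<rho> U"
    and e: "e \<in> mean_zero" "norm e = 1"
  shows "distr U borel (\<lambda>v. (v \<bullet> e / \<rho>)\<^sup>2) = beta_distribution (1 / 2) ((real CARD('n) - 2) / 2)"
proof -
  interpret prob_space U using U by (simp add: uniform_on_msphere_def)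
  define b where "b = (real CARD('n) - 2) / 2"
  have b: "b > 0" using q by (simp add: b_def)
  note beta = beta_distribution[of "1 / 2" b]
  have rv: "random_variable borel (\<lambda>v. (v \<bullet> e / \<rho>)\<^sup>2)"
    using borel_measurable_inner_msphere[OF U, of e] by measurable
  show ?thesis unfolding b_def[symmetric]
  proof (rule real_distribution_eqI_moments)
    show "real_distribution (distr U borel (\<lambda>v. (v \<bullet> e / \<rho>)\<^sup>2))" using rv by simp
    have "(v \<bullet> e / \<rho>)\<^sup>2 \<in> {0..1}" if "v \<in> space U" for v
    proof -
      have "norm v = \<rho>" using that U by (simp add: uniform_on_msphere_def msphere_def)
      then have "\<bar>v \<bullet> e\<bar> \<le> \<rho>" using Cauchy_Schwarz_ineq2[of v e] e by simp
      then have "\<bar>v \<bullet> e / \<rho>\<bar> \<le> 1" using \<rho> by simp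
      then show ?thesis by (simp add: abs_square_le_1)
    qed
    then show "AE x in distr U borel (\<lambda>v. (v \<bullet> e / \<rho>)\<^sup>2). x \<in> {0..1}"
      using rv by (subst AE_distr_iff) auto
    show "real_distribution (beta_distribution (1 / 2) b)" "AE x in beta_distribution (1 / 2) b. x \<in> {0..1}"
      using beta b by auto
    fix k
    have "(\<integral>v. ((v \<bullet> e / \<rho>)\<^sup>2) ^ k \<partial>U) = Beta (1 / 2 + real k) b / Beta (1 / 2) b"
    proof (induction k)
      case 0
      then show ?case using Beta_pos[of "1/2" b] b prob_space by simp
    next
      case (Suc j)
      define I where "I k = (\<integral>v. (v \<bullet> e) ^ (2 * k) \<partial>U)" for k
      have I: "(\<integral>v. ((v \<bullet> e / \<rho>)\<^sup>2) ^ k \<partial>U) = I k / \<rho> ^ (2 * k)" for k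
        by (simp add: I_def power_divide power_mult[symmetric])
      define c where "c = real (2 * j) + real CARD('n) - 1"
      have c: "c > 0" using q by (simp add: c_def)
      have "real (2 * j + 1) * \<rho>\<^sup>2 * I j = c * I (Suc j)"
        unfolding I_def c_def by (rule inner_moment_recurrence[OF U e])
      then have "I (Suc j) / \<rho> ^ (2 * Suc j) = real (2 * j + 1) / c * (I j / \<rho> ^ (2 * j))"
        using c \<rho> by (simp add: field_simps power2_eq_square)
      also have "I j / \<rho> ^ (2 * j) = Beta (1 / 2 + real j) b / Beta (1 / 2) b"
        using Suc I by simp
      also have "real (2 * j + 1) / c * (Beta (1 / 2 + real j) b / Beta (1 / 2) b) =
          Beta (1 / 2 + real (Suc j)) b / Beta (1 / 2) b"
      proof -
        define a where "a = 1 / 2 + real j"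
        have ac: "c = 2 * (a + b)" "real (2 * j + 1) = 2 * a" "1 / 2 + real (Suc j) = a + 1"
          by (simp_all add: a_def b_def c_def field_simps)
        have "a \<notin> \<int>\<^sub>\<le>\<^sub>0" by (auto simp: a_def elim!: nonpos_Ints_cases)
        then have "(a + b) * Beta (a + 1) b = a * Beta a b" by (rule Beta_plus1_left)
        then have "c * Beta (1 / 2 + real (Suc j)) b = real (2 * j + 1) * Beta (1 / 2 + real j) b"
          unfolding ac a_def[symmetric] by (simp only: mult.assoc)
        then have "Beta (1 / 2 + real (Suc j)) b = real (2 * j + 1) / c * Beta (1 / 2 + real j) b"
          using c by (simp add: field_simps)
        then show ?thesis by simp
      qed
      finally show ?case unfolding I .
    qed
    then show "(\<integral>x. x ^ k \<partial>distr U borel (\<lambda>v. (v \<bullet> e / \<rho>)\<^sup>2)) = (\<integral>x. x ^ k \<partial>beta_distribution (1 / 2) b)"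
      using rv b by (simp add: integral_distr beta(3))
  qed
qed

section \<open>From tails of the beta distribution to the measure of caps\<close>

lemma measure_beta_distribution_greaterThan:
  assumes a: "0 < a" and b: "0 < b" and s: "0 \<le> s"
  shows "measure (beta_distribution a b) {s<..} =
    integral {s..1} (\<lambda>z. z powr (a - 1) * (1 - z) powr (b - 1)) / Beta a b"
proof -
  define f where "f z = z powr (a - 1) * (1 - z) powr (b - 1)" for z :: real
  have B: "0 < Beta a b" using a b by (rule Beta_pos)
  have "f integrable_on {0..1}" using has_integral_Beta_real[OF a b] unfolding f_def by blast
  then have "f integrable_on {s..1}" by (rule integrable_on_subinterval) (use s in auto)
  then have "((\<lambda>z. f z / Beta a b) has_integral (integral {s..1} f / Beta a b)) {s..1}"
    by (intro has_integral_divide integrable_integral)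
  then have I: "(\<integral>\<^sup>+z. indicator {s..1} z * (f z / Beta a b) \<partial>lborel) = ennreal (integral {s..1} f / Beta a b)"
    using B by (intro nn_integral_has_integral_lebesgue) (auto simp: f_def)
  have "emeasure (beta_distribution a b) {s<..} =
      (\<integral>\<^sup>+z. ennreal (beta_density a b z) * indicator {s<..} z \<partial>lborel)"
    unfolding beta_distribution_def by (rule emeasure_density) simp_all
  also have "\<dots> = (\<integral>\<^sup>+z. indicator {s..1} z * (f z / Beta a b) \<partial>lborel)"
  proof (rule nn_integral_cong_AE)
    show "AE z in lborel. ennreal (beta_density a b z) * indicator {s<..} z =
        ennreal (indicator {s..1} z * (f z / Beta a b))"
      \<comment> \<open>The open ray and the closed interval of integration differ at the null point
        \<open>s\<close>.\<close>
      using AE_lborel_singleton[of s]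
      by eventually_elim (use s in \<open>auto simp: beta_density_def f_def indicator_def\<close>)
  qed
  finally have "emeasure (beta_distribution a b) {s<..} = ennreal (integral {s..1} f / Beta a b)"
    unfolding I .
  moreover have "0 \<le> integral {s..1} f"
    using \<open>f integrable_on {s..1}\<close> by (rule integral_nonneg) (simp add: f_def)
  ultimately show ?thesis using B by (simp add: measure_def f_def[abs_def])
qed

text \<open>The substitution z = v^2: the derivative 2 v cancels the factor z^(-1/2). The point 0 is
  excluded from the comparison, since there \<open>powr\<close> gives 0 on one side while the other
  integrand is 2.\<close>

lemma integral_beta_substitute_square:
  fixes b t :: real
  assumes b: "0 < b" and t: "0 \<le> t" "t \<le> 1"
  shows "(\<lambda>v. (1 - v\<^sup>2) powr (b - 1)) integrable_on {t..1}" (is ?int)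
    and "integral {t\<^sup>2..1} (\<lambda>z. z powr (1 / 2 - 1) * (1 - z) powr (b - 1)) =
      2 * integral {t..1} (\<lambda>v. (1 - v\<^sup>2) powr (b - 1))" (is ?eq)
proof -
  define f where "f z = z powr (1 / 2 - 1) * (1 - z) powr (b - 1)" for z :: real
  have "f integrable_on {0..1}" using has_integral_Beta_real[of "1 / 2" b] b unfolding f_def by auto
  then have "f integrable_on {t\<^sup>2..1}" by (rule integrable_on_subinterval) auto
  then have abs: "f absolutely_integrable_on {t\<^sup>2..1}"
    by (rule nonnegative_absolutely_integrable_1) (simp add: f_def)
  have im: "(\<lambda>x. x\<^sup>2) ` {t..1} = {t\<^sup>2..1}"
  proof (intro equalityI subsetI)
    fix z assume "z \<in> {t\<^sup>2..1}"
    then have "0 \<le> z" "t\<^sup>2 \<le> z" "z \<le> 1" using order_trans[OF zero_le_power2[of t]] by auto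
    then have "z = (sqrt z)\<^sup>2" "sqrt z \<in> {t..1}"
      by (auto simp: real_le_rsqrt)
    then show "z \<in> (\<lambda>x. x\<^sup>2) ` {t..1}" by blast
  qed (use t in \<open>auto intro: power_mono power_le_one\<close>)
  have *: "(\<lambda>x. \<bar>2 * x\<bar> * f (x\<^sup>2)) absolutely_integrable_on {t..1} \<and>
      integral {t..1} (\<lambda>x. \<bar>2 * x\<bar> * f (x\<^sup>2)) = integral {t\<^sup>2..1} f"
  proof (subst has_absolute_integral_change_of_variables_1'[where g = "\<lambda>x. x\<^sup>2"])
    show "((\<lambda>x. x\<^sup>2) has_real_derivative 2 * x) (at x within {t..1})" for x
      by (auto intro!: derivative_eq_intros)
    show "inj_on (\<lambda>x. x\<^sup>2) {t..1}"
      using t by (intro inj_onI) (auto simp: power2_eq_iff_nonneg)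
  qed (use abs im in auto)
  have spike: "2 * (1 - x\<^sup>2) powr (b - 1) = \<bar>2 * x\<bar> * f (x\<^sup>2)" if "x \<in> {t..1} - {0}" for x
  proof -
    have x: "0 < x" using that t by auto
    have "(x\<^sup>2) powr (1 / 2 - 1) = inverse x"
      using x by (simp add: powr_minus powr_half_sqrt)
    then show ?thesis using x by (simp add: f_def)
  qed
  have "(\<lambda>x. \<bar>2 * x\<bar> * f (x\<^sup>2)) integrable_on {t..1}"
    using * by (simp add: absolutely_integrable_on_def)
  then have "(\<lambda>x. 2 * (1 - x\<^sup>2) powr (b - 1)) integrable_on {t..1}"
    by (rule integrable_spike[OF _ negligible_sing[of 0]]) (rule spike)
  then have "(\<lambda>x. 2 * (1 - x\<^sup>2) powr (b - 1) / 2) integrable_on {t..1}"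
    by (rule integrable_on_divide)
  then show ?int by simp
  have "integral {t\<^sup>2..1} f = integral {t..1} (\<lambda>x. \<bar>2 * x\<bar> * f (x\<^sup>2))" using * by simp
  also have "\<dots> = integral {t..1} (\<lambda>x. 2 * (1 - x\<^sup>2) powr (b - 1))"
    by (rule integral_spike[OF negligible_sing[of 0]]) (rule spike)
  finally show ?eq by (simp add: f_def[abs_def])
qed

text \<open>For t \<ge> 0 the caps around \<open>e\<close> and \<open>- e\<close> are disjoint, and
  they have equal measure by invariance. Their union is the event that the squared normalised
  coordinate exceeds t^2, so twice the measure of the cap is a tail of the beta distribution. The 2
  produced by the substitution z = v^2 cancels the doubling.\<close>

proposition measure_cap:
  fixes U :: "'n::{finite,wellorder} rvec measure"
  assumes q: "CARD('n) \<ge> 3" and \<rho>: "\<rho> > 0" and U: "uniform_on_msphere \<rho> U"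
    and w: "w \<in> msphere \<rho>" and t: "0 \<le> t" "t \<le> 1"
  shows "measure U (cap \<rho> w t) = cap_beta CARD('n) t"
proof -
  interpret prob_space U using U by (simp add: uniform_on_msphere_def)
  define b where "b = (real CARD('n) - 2) / 2"
  have b: "b > 0" using q by (simp add: b_def)
  define e where "e = w /\<^sub>R \<rho>"
  have e: "e \<in> mean_zero" "norm e = 1" "- e \<in> mean_zero"
    using w \<rho> by (simp_all add: e_def msphere_def mean_zero_def)
  have spU: "space U = msphere \<rho>" using U by (simp add: uniform_on_msphere_def)
  have m [measurable]: "(\<lambda>v. v \<bullet> u) \<in> borel_measurable U" for u
    by (rule borel_measurable_inner_msphere[OF U])
  define H where "H u = (\<lambda>v. v \<bullet> u) -` {\<rho> * t<..} \<inter> space U" for u :: "'n rvec"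
  have Hs: "H u \<in> sets U" for u unfolding H_def by measurable
  have "cap \<rho> w t = H e"
    using \<rho> by (auto simp: cap_def H_def spU e_def field_simps power2_eq_square)
  moreover have "measure U (H (- e)) = measure U (H e)"
    using arg_cong[OF distr_inner_eq[OF U e(1,3)], of "\<lambda>M. measure M {\<rho> * t<..}"]
    by (simp add: measure_distr H_def)
  moreover have "H e \<inter> H (- e) = {}"
    using mult_nonneg_nonneg[of \<rho> t] \<rho> t by (auto simp: H_def simp del: mult_nonneg_nonneg)
  ultimately have "2 * measure U (cap \<rho> w t) = measure U (H e \<union> H (- e))"
    using Hs by (simp add: finite_measure_Union)
  also have "H e \<union> H (- e) = (\<lambda>v. (v \<bullet> e / \<rho>)\<^sup>2) -` {t\<^sup>2<..} \<inter> space U"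
  proof -
    have sq: "t\<^sup>2 < x\<^sup>2 \<longleftrightarrow> t < x \<or> t < - x" for x :: real
    proof -
      have "x\<^sup>2 \<le> t\<^sup>2 \<longleftrightarrow> \<bar>x\<bar> \<le> t" using abs_le_square_iff[of x t] t by simp
      then show ?thesis by (simp add: not_le[symmetric] abs_le_iff)
    qed
    have "v \<in> H e \<union> H (- e) \<longleftrightarrow> v \<in> space U \<and> (t < v \<bullet> e / \<rho> \<or> t < - (v \<bullet> e / \<rho>))" for v
      using \<rho> by (auto simp: H_def field_simps)
    then show ?thesis unfolding sq[symmetric] by auto
  qed
  also have "measure U \<dots> = measure (beta_distribution (1 / 2) b) {t\<^sup>2<..}"
    unfolding b_def distr_inner_square[OF q \<rho> U e(1,2), symmetric] by (subst measure_distr) auto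
  also have "\<dots> = 2 * integral {t..1} (\<lambda>v. (1 - v\<^sup>2) powr (b - 1)) / Beta (1 / 2) b"
    using measure_beta_distribution_greaterThan[of "1 / 2" b "t\<^sup>2"]
      integral_beta_substitute_square(2)[OF b t] b by simp
  finally have "measure U (cap \<rho> w t) = integral {t..1} (\<lambda>v. (1 - v\<^sup>2) powr (b - 1)) / Beta (1 / 2) b"
    by simp
  moreover have eqs: "real CARD('n) / 2 - 2 = b - 1" "(real CARD('n) - 1) / 2 = 1 / 2 + b"
    "(real CARD('n) - 2) / 2 = b"
    by (simp_all add: b_def field_simps)
  ultimately show ?thesis unfolding cap_beta_def eqs by (simp add: Beta_def)
qed

text \<open>The difference is a positive factor times the integral over [s,t]. As t < 1, the
  integrand is continuous and positive there, away from its singularity at 1 when q = 3.\<close>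

lemma cap_beta_strict_antimono:
  assumes q: "q \<ge> 3" and s: "0 \<le> s" "s < t" "t < 1"
  shows "cap_beta q t < cap_beta q s"
proof -
  define f where "f v = (1 - v\<^sup>2) powr (real q / 2 - 2)" for v :: real
  have int: "f integrable_on {s..1}"
    using integral_beta_substitute_square(1)[of "real q / 2 - 1" s] q s by (simp add: f_def[abs_def])
  have pos: "0 < 1 - v\<^sup>2" if "v \<in> {s..t}" for v
    using that s by (auto simp: abs_square_less_1)
  have nz: "1 - v\<^sup>2 \<noteq> 0" if "v \<in> {s..t}" for v using pos[OF that] by linarith
  have cont: "continuous_on {s..t} f"
    unfolding f_def
    by (intro continuous_on_powr ballI nz) (auto intro!: continuous_intros)
  have fpos: "f v > 0" if "v \<in> {s..t}" for v using pos[OF that] by (simp add: f_def)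
  then have "integral {s..t} f = 0 \<longleftrightarrow> (\<forall>v\<in>{s..t}. f v = 0)"
    using s(2) by (intro integral_eq_0_iff[OF cont]) (auto simp: less_imp_le)
  moreover have "f s \<noteq> 0" "s \<in> {s..t}" using fpos[of s] s(2) by auto
  ultimately have "integral {s..t} f \<noteq> 0" by blast
  moreover have "0 \<le> integral {s..t} f"
    by (rule integral_nonneg[OF integrable_on_subinterval[OF int]]) (use s in \<open>auto simp: f_def\<close>)
  moreover have "integral {s..t} f + integral {t..1} f = integral {s..1} f"
    using s by (intro Henstock_Kurzweil_Integration.integral_combine[OF _ _ int]) simp_all
  ultimately have less: "integral {t..1} f < integral {s..1} f" by linarith
  have "0 < Gamma ((real q - 1) / 2) / (Gamma (1 / 2) * Gamma ((real q - 2) / 2))"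
    using q by (intro divide_pos_pos mult_pos_pos Gamma_real_pos) simp_all
  from mult_strict_left_mono[OF less this] show ?thesis
    by (simp only: cap_beta_def f_def[abs_def])
qed

section \<open>The minimizer\<close>

text \<open>The supremum ranges over thresholds down to -1, but emptiness forces \<open>t\<close>
  \<ge> \<open>min_inner z\<close> \<ge> 0. Hence \<open>measure_cap\<close> covers every cap that
  occurs, and by monotonicity the smallest threshold gives the largest measure.\<close>

lemma LECD_perm_orbit:
  fixes z :: "'n::{finite,wellorder} rvec"
  assumes q: "CARD('n) \<ge> 3" and \<rho>: "\<rho> > 0" and U: "uniform_on_msphere \<rho> U"
    and z: "z \<in> unit_ascending"
  shows "LECD \<rho> U (perm_orbit (\<rho> *\<^sub>R z)) = cap_beta CARD('n) (min_inner z)"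
  unfolding LECD_def
proof (rule cSup_eq_maximum)
  have q2: "CARD('n) \<ge> 2" using q by simp
  have z': "z \<in> ascending" "norm z = 1" using z by (auto simp: unit_ascending_def)
  have m: "0 \<le> min_inner z" "min_inner z < 1"
    using min_inner_nonneg[OF q2 z'(1)] min_inner_less_1[OF q z'(2)] by auto
  note cap = measure_cap[OF q \<rho> U]
  obtain w where w: "w \<in> msphere \<rho>" "perm_orbit (\<rho> *\<^sub>R z) \<inter> cap \<rho> w (min_inner z) = {}"
    using empty_cap_min_inner[OF q2 \<rho> z'(1)] .
  then have "cap_beta CARD('n) (min_inner z) = measure U (cap \<rho> w (min_inner z))"
    using cap[OF w(1)] m by simp
  moreover have "- 1 \<le> min_inner z" using m by simp
  ultimately show "cap_beta CARD('n) (min_inner z) \<in> {measure U (cap \<rho> w t) |w t.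
      w \<in> msphere \<rho> \<and> - 1 \<le> t \<and> t < 1 \<and> perm_orbit (\<rho> *\<^sub>R z) \<inter> cap \<rho> w t = {}}"
    using w m(2) by blast
  fix x assume "x \<in> {measure U (cap \<rho> w t) |w t.
      w \<in> msphere \<rho> \<and> - 1 \<le> t \<and> t < 1 \<and> perm_orbit (\<rho> *\<^sub>R z) \<inter> cap \<rho> w t = {}}"
  then obtain w t where x: "x = measure U (cap \<rho> w t)" and w: "w \<in> msphere \<rho>" and t: "t < 1"
      and empty: "perm_orbit (\<rho> *\<^sub>R z) \<inter> cap \<rho> w t = {}"
    by blast
  have le: "min_inner z \<le> t" by (rule empty_cap_imp_ge[OF q2 \<rho> z w empty])
  then have "x = cap_beta CARD('n) t" using cap[OF w] m t x by simp
  then show "x \<le> cap_beta CARD('n) (min_inner z)"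
    using cap_beta_strict_antimono[OF q m(1), of t] le t by (cases "min_inner z = t") auto
qed

theorem proposition4p1:
  fixes U :: "'n::{finite,wellorder} rvec measure"
    and q :: nat and \<rho> :: real
  assumes "q = CARD('n)" and "q \<ge> 3"
    and "\<rho> = norm (ybar :: 'n rvec)"
    and "uniform_on_msphere \<rho> U"
  shows
    "(zhat :: 'n rvec) \<in> unit_ascending \<and>
     min_inner (zhat :: 'n rvec) = Lambda_hat TYPE('n) \<and>
     (\<forall>z :: 'n rvec. z \<in> unit_ascending \<and> z \<noteq> zhat \<longrightarrow> min_inner z < Lambda_hat TYPE('n)) \<and>
     (yhat :: 'n rvec) = sqrt (real q * ((real q)\<^sup>2 - 1) / 12) *\<^sub>R (ahat /\<^sub>R norm (ahat :: 'n rvec)) \<and>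
     (yhat :: 'n rvec) \<in> msphere \<rho> \<inter> ascending \<and>
     (\<forall>y :: 'n rvec. y \<in> msphere \<rho> \<inter> ascending \<and> y \<noteq> yhat \<longrightarrow>
        LECD \<rho> U (perm_orbit yhat) < LECD \<rho> U (perm_orbit y) \<and>
        LECAD \<rho> (perm_orbit (yhat :: 'n rvec)) < LECAD \<rho> (perm_orbit y)) \<and>
     (q \<ge> 4 \<longrightarrow> (yhat :: 'n rvec) \<noteq> ybar) \<and>
     LECD \<rho> U (perm_orbit yhat) = cap_beta q (1 / norm (ahat :: 'n rvec) * sqrt (3 / (real q + 1))) \<and>
     LECAD \<rho> (perm_orbit (yhat :: 'n rvec)) = arccos (1 / norm (ahat :: 'n rvec) * sqrt (3 / (real q + 1)))"
proof -
  define m where "m = min_inner (zhat :: 'n rvec)"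
  have q3: "CARD('n) \<ge> 3" and q2: "CARD('n) \<ge> 2" using assms by auto
  have norm_y: "norm (ybar :: 'n rvec) = sqrt (real q * ((real q)\<^sup>2 - 1) / 12)"
    using norm_ybar[where 'n='n] assms(1) by simp
  have "1 < (real q)\<^sup>2" using assms(2) by (simp add: one_less_power)
  then have \<rho>: "\<rho> > 0" using assms(2,3) norm_y by simp
  have zhat: "(zhat :: 'n rvec) \<in> unit_ascending" by (rule zhat_unit_ascending[OF q2])
  have yhat: "(yhat :: 'n rvec) = \<rho> *\<^sub>R zhat" by (simp add: yhat_def assms(3))
  have m: "m = 1 / norm (ahat :: 'n rvec) * sqrt (3 / (real q + 1))"
    unfolding m_def assms(1) by (rule min_inner_zhat[OF q2])
  have m1: "m < 1"
    using min_inner_less_1[OF q3, of zhat] zhat by (simp add: m_def unit_ascending_def)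
  have less: "min_inner z < m" if "z \<in> unit_ascending" "z \<noteq> zhat" for z :: "'n rvec"
    using min_inner_less_zhat[OF q2, of z] that by (simp add: m_def unit_ascending_def)
  have scale: "\<rho> *\<^sub>R z \<in> msphere \<rho> \<inter> ascending" if "z \<in> unit_ascending" for z :: "'n rvec"
    using that \<rho> by (auto simp: unit_ascending_def msphere_def mean_zero_def ascending_def)
  have D: "LECD \<rho> U (perm_orbit (\<rho> *\<^sub>R z)) = cap_beta q (min_inner z)"
    and A: "LECAD \<rho> (perm_orbit (\<rho> *\<^sub>R z)) = arccos (min_inner z)"
    if "z \<in> unit_ascending" for z :: "'n rvec"
    using LECD_perm_orbit[OF q3 \<rho> assms(4) that] LECAD_perm_orbit[OF q3 \<rho> that] assms(1) by auto
  have minimizer: "LECD \<rho> U (perm_orbit yhat) < LECD \<rho> U (perm_orbit y) \<and>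
      LECAD \<rho> (perm_orbit (yhat :: 'n rvec)) < LECAD \<rho> (perm_orbit y)"
    if y: "y \<in> msphere \<rho> \<inter> ascending" "y \<noteq> yhat" for y :: "'n rvec"
  proof -
    \<comment> \<open>Rescaling turns the sphere of radius \<rho> into unit vectors, for which both
      discrepancies are functions of \<open>min_inner\<close> alone.\<close>
    define z where "z = y /\<^sub>R \<rho>"
    have z: "z \<in> unit_ascending"
      using y(1) \<rho> by (auto simp: z_def unit_ascending_def msphere_def mean_zero_def ascending_def divide_right_mono)
    have yz: "y = \<rho> *\<^sub>R z" using \<rho> by (simp add: z_def)
    then have "z \<noteq> zhat" using y(2) yhat by auto
    then have "min_inner z < m" by (rule less[OF z])
    moreover have "0 \<le> min_inner z"
      using z by (intro min_inner_nonneg[OF q2]) (simp add: unit_ascending_def)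
    \<comment> \<open>Both \<open>cap_beta q\<close> and \<open>arccos\<close> are strictly
      decreasing on [0,1), so the strictly largest \<open>min_inner\<close> gives the strictly
      smallest discrepancies.\<close>
    ultimately have "cap_beta q m < cap_beta q (min_inner z)" "arccos m < arccos (min_inner z)"
      using m1 by (auto intro: cap_beta_strict_antimono[OF assms(2)] arccos_less_arccos)
    then show ?thesis
      unfolding yz yhat D[OF z] A[OF z] D[OF zhat] A[OF zhat] m_def[symmetric] by (rule conjI)
  qed
  have yhat_eq: "(yhat :: 'n rvec) = sqrt (real q * ((real q)\<^sup>2 - 1) / 12) *\<^sub>R (ahat /\<^sub>R norm (ahat :: 'n rvec))"
    by (simp only: yhat_def zhat_def norm_y)
  have yhat_in: "(yhat :: 'n rvec) \<in> msphere \<rho> \<inter> ascending" using scale[OF zhat] yhat by simp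
  have neq: "q \<ge> 4 \<longrightarrow> (yhat :: 'n rvec) \<noteq> ybar" using yhat_neq_ybar assms(1) by blast
  have Lambda: "min_inner (zhat :: 'n rvec) = Lambda_hat TYPE('n)" by (rule Lambda_hat_eq[OF q2, symmetric])
  then have unique: "min_inner z < Lambda_hat TYPE('n)" if "z \<in> unit_ascending" "z \<noteq> zhat" for z :: "'n rvec"
    using less[OF that] by (simp add: m_def)
  have LECD_yhat: "LECD \<rho> U (perm_orbit yhat) = cap_beta q (1 / norm (ahat :: 'n rvec) * sqrt (3 / (real q + 1)))"
    unfolding yhat D[OF zhat] m[symmetric] m_def ..
  have LECAD_yhat: "LECAD \<rho> (perm_orbit (yhat :: 'n rvec)) = arccos (1 / norm (ahat :: 'n rvec) * sqrt (3 / (real q + 1)))"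
    unfolding yhat A[OF zhat] m[symmetric] m_def ..
  have unique': "\<forall>z :: 'n rvec. z \<in> unit_ascending \<and> z \<noteq> zhat \<longrightarrow> min_inner z < Lambda_hat TYPE('n)"
    using unique by blast
  have minimizer': "\<forall>y :: 'n rvec. y \<in> msphere \<rho> \<inter> ascending \<and> y \<noteq> yhat \<longrightarrow>
        LECD \<rho> U (perm_orbit yhat) < LECD \<rho> U (perm_orbit y) \<and>
        LECAD \<rho> (perm_orbit (yhat :: 'n rvec)) < LECAD \<rho> (perm_orbit y)"
    by (intro allI impI, elim conjE, rule minimizer)
  show ?thesis
    by (intro conjI zhat Lambda unique' yhat_eq yhat_in minimizer' neq LECD_yhat LECAD_yhat)
qed

end
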